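(* Assume (no unbiasedness of the stochastic gradients is assumed): (1) the undirected communication graph $\mathcal G$ is connected; (2) the minimum value $f^*=\min_{x\in\mathbb R^p} f(x)$ is finite; (3) each $f_i$ is smooth with constant $L_f>0$: $\|\nabla f_i(x)-\nabla f_i(y)\|\le L_f\|x-y\|$ for all $x,y\in\mathbb R^p$; (4) the random variables $\{\xi_{i,k}: i\in[n], k\in\mathbb N_0\}$ are independent of each other; (5) there is a constant $\sigma$ such that $\mathbf E_{\xi_{i,k}}[\|g_i(x,\xi_{i,k})-\nabla f_i(x)\|^2]\le\sigma^2$ for all $i\in[n]$, $k\in\mathbb N_0$, $x\in\mathbb R^p$; (6) $f$ satisfies the Polyak--Łojasiewicz condition with constant $\nu>0$: $\frac12\|\nabla f(x)\|^2\ge\nu(f(x)-f^* )$ for all $x\in\mathbb R^p$. Let $\{x_{i,k}\}$ be generated by the distributed primal--dual SGD algorithm with $$\alpha_k=\alpha=\kappa_1\beta,\quad\beta_k=\beta,\quad\eta_k=\eta=\frac{\kappa_2}{\beta},\quad\forall k\in\mathbb N_0,$$ where $\kappa_1>c_1$, $\kappa_2\in(0,c_2(\kappa_1))$, and $\beta\ge\breve c_0(\kappa_1,\kappa_2)$. Then $$\mathbf E\Big[\frac1n\sum_{i=1}^n\|x_{i,k}-\bar x_k\|^2+f(\bar x_k)-f^*\Big]\le(1-\eta\varepsilon)^kc_4+\breve c_5\sigma^2,\quad\forall k\in\mathbb N_+,$$ where $\varepsilon\in(0,1/\eta)$ and $c_4,\breve c_5>0$ are the constants $$\varepsilon=\frac1{\kappa_5}\min\Big\{\frac{\varepsilon_3}\eta,\frac{\varepsilon_4}\eta,\frac\nu2\Big\},\qquad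 c_4=\frac{W_0}{n\kappa_6},\qquad \breve c_5=\frac{3+5\eta}{\varepsilon\kappa_6}.$$
   Context: Setting. There are $n$ agents, $[n]=\{1,\dots,n\}$; agent $i$ has a differentiable (possibly nonconvex) cost $f_i:\mathbb R^p\to\mathbb R$, and $f=\frac1n\sum_{i=1}^n f_i$. The undirected communication graph is $\mathcal G=(\{1,\dots,n\},\mathcal E)$ with weighted Laplacian $L=(L_{ij})$ (symmetric; for $i\ne j$, $L_{ij}<0$ if $(i,j)\in\mathcal E$ and $L_{ij}=0$ otherwise; $L_{ii}=-\sum_{j\neq i}L_{ij}$). $\rho(\cdot)$ is the spectral radius and $\rho_2(L)$ the smallest positive eigenvalue of $L$. $\|\cdot\|$ is the Euclidean norm, and $\|x\|_A^2=x^\top Ax$ for a square matrix $A$. Distributed primal--dual SGD algorithm. Given deterministic positive parameters $\alpha_k,\beta_k,\eta_k$, deterministic $x_{i,0}\in\mathbb R^p$, and $v_{i,0}=0$, for all $k\in\mathbb N_0$, $i\in[n]$: $$x_{i,k+1}=x_{i,k}-\eta_k\Big(\alpha_k\sum_{j=1}^nL_{ij}x_{j,k}+\beta_kv_{i,k}+g_i(x_{i,k},\xi_{i,k})\Big),\qquad v_{i,k+1}=v_{i,k}+\eta_k\beta_k\sum_{j=1}^nL_{ij}x_{j,k},$$ where $g_i(x,\xi_{i,k})$ is a stochastic estimate of $\nabla f_i(x)$ and $\xi_{i,k}$ is a random variable. $\bar x_k=\frac1n\sum_{i=1}^nx_{i,k}$. Constants: $c_1=\frac1{\rho_2(L)}+1$,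 $\varepsilon_1=(\kappa_1-1)\rho_2(L)-1$, $\varepsilon_2=\rho(L)+(2\kappa_1^2+1)\rho(L^2)+1$, $c_2(\kappa_1)=\min\{\varepsilon_1/\varepsilon_2,\,1/5\}$, $\kappa_3=\frac1{\rho_2(L)}+\kappa_1+1$, $\kappa_4=\frac1{\rho_2(L)}+\kappa_1+\frac32$, $\kappa_5=\frac{\kappa_1+1}2+\frac1{2\rho_2(L)}$, $\kappa_6=\min\{\frac1{2\rho(L)},\frac{\kappa_1-1}{2\kappa_1}\}$, $\varepsilon_3=\varepsilon_1\kappa_2-\varepsilon_2\kappa_2^2$, $\varepsilon_4=\frac12(\kappa_2-5\kappa_2^2)$, $\varepsilon_6=\max\{\frac12(2+3L_f^2),\kappa_3\}$, $\varepsilon_5=L_f+\frac{1}{\kappa_2\varepsilon_6}\kappa_3L_f^2+\frac2{\varepsilon_6^2}\kappa_4L_f^2$, $\breve\varepsilon_6=\max\{1+3L_f^2,\kappa_3\}$, $\breve c_0(\kappa_1,\kappa_2)=\max\{4\kappa_2\varepsilon_5,\breve\varepsilon_6\}$. Initial Lyapunov value: with $\boldsymbol x_0=(x_{1,0},\dots,x_{n,0})$ and $\boldsymbol v_0=(v_{1,0},\dots,v_{n,0})$ stacked in $\mathbb R^{np}$, $\boldsymbol g_0^0=(\nabla f_1(\bar x_0),\dots,\nabla f_n(\bar x_0))\in\mathbb R^{np}$, $\boldsymbol K=(I_n-\frac1n\mathbf 1_n\mathbf 1_n^\top)\otimes I_p$, $\boldsymbol Q=L^{+}\otimes I_p$ with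 $L^+=R\Lambda_1^{-1}R^\top$ the Moore--Penrose pseudoinverse of $L$ ($\Lambda_1=\mathrm{diag}(\lambda_2,\dots,\lambda_n)$ the nonzero eigenvalues of $L$, columns of $R$ corresponding orthonormal eigenvectors), $$W_0=\tfrac12\|\boldsymbol x_0\|_{\boldsymbol K}^2+\tfrac12\Big\|\boldsymbol v_0+\tfrac1\beta\boldsymbol g_0^0\Big\|^2_{\boldsymbol Q+\kappa_1\boldsymbol K}+\boldsymbol x_0^\top\boldsymbol K\Big(\boldsymbol v_0+\tfrac1\beta\boldsymbol g_0^0\Big)+n(f(\bar x_0)-f^* ).$$
   Formalization: The claim c_4 > 0 fails when W_0 = 0 (e.g. all f_i equal and all x_{i,0} at a common minimiser); what is proved is c_4 ≥ 0, with c_4 > 0 whenever W_0 ≠ 0. The number of agents is taken to be n ≥ 2, so that ρ_2(L) exists. *)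

theory Defs
  imports "HOL-Probability.Probability"
begin

section \<open>Communication graph and Laplacian\<close>

definition connected_graph :: "('n \<times> 'n) set \<Rightarrow> bool" where
  "connected_graph E \<longleftrightarrow> sym E \<and> (\<forall>i j. (i, j) \<in> E\<^sup>*)"

definition weighted_laplacian :: "('n::finite \<times> 'n) set \<Rightarrow> real^'n^'n \<Rightarrow> bool" where
  "weighted_laplacian E L \<longleftrightarrow>
     (\<forall>i j. L $ i $ j = L $ j $ i) \<and>
     (\<forall>i j. i \<noteq> j \<longrightarrow> (if (i, j) \<in> E then L $ i $ j < 0 else L $ i $ j = 0)) \<and>
     (\<forall>i. L $ i $ i = - (\<Sum>j\<in>UNIV - {i}. L $ i $ j))"

section \<open>Spectral quantities of real matrices\<close>

text \<open>Eigenvalues of a real matrix are taken over the complex numbers.\<close>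

definition spectrum :: "real^'n^'n \<Rightarrow> complex set" where
  "spectrum A = {c. \<exists>u::complex^'n. u \<noteq> 0 \<and> (\<chi> i j. complex_of_real (A $ i $ j)) *v u = c *s u}"

definition spectral_radius :: "real^'n^'n \<Rightarrow> real" where
  "spectral_radius A = Max (cmod ` spectrum A)"

definition min_pos_eigenvalue :: "real^'n^'n \<Rightarrow> real" where
  "min_pos_eigenvalue A = Min {r. 0 < r \<and> complex_of_real r \<in> spectrum A}"

text \<open>The Laplacian of a connected graph on \<open>n\<close> vertices has exactly \<open>n - 1\<close> nonzero
  eigenvalues (with multiplicity), indexed here by \<open>{2..n}\<close>; \<open>r m\<close> is the eigenvector
  that forms the corresponding column of \<open>R\<close>.\<close>

definition nonzero_eigensystem :: "real^'n^'n \<Rightarrow> (nat \<Rightarrow> real) \<Rightarrow> (nat \<Rightarrow> real^'n) \<Rightarrow> bool" where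
  "nonzero_eigensystem L lam r \<longleftrightarrow>
     (\<forall>m\<in>{2..CARD('n)}. lam m \<noteq> 0 \<and> L *v r m = lam m *\<^sub>R r m) \<and>
     (\<forall>a\<in>{2..CARD('n)}. \<forall>b\<in>{2..CARD('n)}. r a \<bullet> r b = (if a = b then 1 else 0))"

text \<open>The Moore--Penrose pseudoinverse as \<open>R \<Lambda>\<^sub>1\<^sup>-\<^sup>1 R\<^sup>T\<close>, written entrywise. The matrix does not
  depend on which eigensystem is chosen. The definition is meaningful only for
  symmetric matrices with one-dimensional kernel.\<close>

definition laplacian_pinv :: "real^'n^'n \<Rightarrow> real^'n^'n" where
  "laplacian_pinv L =
     (SOME P. \<exists>lam r. nonzero_eigensystem L lam r \<and>
        P = (\<chi> i j. \<Sum>m = 2..CARD('n). r m $ i * inverse (lam m) * r m $ j))"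

section \<open>Stacked vectors\<close>

definition kronecker :: "real^'b^'a \<Rightarrow> real^'d^'c \<Rightarrow> real^('b \<times> 'd)^('a \<times> 'c)" where
  "kronecker A B = (\<chi> s t. A $ fst s $ fst t * B $ snd s $ snd t)"

definition stack :: "('n::finite \<Rightarrow> real^'p::finite) \<Rightarrow> real^('n \<times> 'p)" where
  "stack x = (\<chi> s. x (fst s) $ snd s)"

definition sqnorm_wrt :: "real^'m^'m \<Rightarrow> real^'m \<Rightarrow> real" where
  "sqnorm_wrt A x = x \<bullet> (A *v x)"

definition matrix_K :: "real^('n::finite \<times> 'p::finite)^('n \<times> 'p)" where
  "matrix_K = kronecker (mat 1 - (1 / real CARD('n)) *\<^sub>R (\<chi> i j. 1)) (mat 1)"

definition matrix_Q :: "real^'n^'n \<Rightarrow> real^('n::finite \<times> 'p::finite)^('n \<times> 'p)" where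
  "matrix_Q L = kronecker (laplacian_pinv L) (mat 1)"

section \<open>Costs\<close>

definition grad :: "('a::real_inner \<Rightarrow> real) \<Rightarrow> 'a \<Rightarrow> 'a" where
  "grad f x = (THE d. GDERIV f x :> d)"

definition mean :: "('n::finite \<Rightarrow> 'a::real_vector) \<Rightarrow> 'a" where
  "mean x = (1 / real CARD('n)) *\<^sub>R (\<Sum>i\<in>UNIV. x i)"

definition avg_cost :: "('n::finite \<Rightarrow> 'a \<Rightarrow> real) \<Rightarrow> 'a \<Rightarrow> real" where
  "avg_cost f x = (1 / real CARD('n)) * (\<Sum>i\<in>UNIV. f i x)"

definition is_min_value :: "('a \<Rightarrow> real) \<Rightarrow> real \<Rightarrow> bool" where
  "is_min_value f fstar \<longleftrightarrow> fstar \<in> range f \<and> (\<forall>x. fstar \<le> f x)"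

section \<open>The distributed primal--dual SGD algorithm\<close>

text \<open>\<open>\<Omega>\<close> is the sample space; \<open>x i k \<omega>\<close> and \<open>v i k \<omega>\<close> are the iterates of agent \<open>i\<close>.\<close>

definition primal_dual_sgd ::
  "'w set \<Rightarrow> real^'n^'n \<Rightarrow> (nat \<Rightarrow> real) \<Rightarrow> (nat \<Rightarrow> real) \<Rightarrow> (nat \<Rightarrow> real) \<Rightarrow>
   ('n::finite \<Rightarrow> real^'p \<Rightarrow> 'z \<Rightarrow> real^'p) \<Rightarrow> ('n \<Rightarrow> nat \<Rightarrow> 'w \<Rightarrow> 'z) \<Rightarrow> ('n \<Rightarrow> real^'p) \<Rightarrow>
   ('n \<Rightarrow> nat \<Rightarrow> 'w \<Rightarrow> real^'p) \<Rightarrow> ('n \<Rightarrow> nat \<Rightarrow> 'w \<Rightarrow> real^'p) \<Rightarrow> bool" where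
  "primal_dual_sgd \<Omega> L \<alpha> \<beta> \<eta> g \<xi> x0 x v \<longleftrightarrow>
     (\<forall>\<omega>\<in>\<Omega>. \<forall>i.
        x i 0 \<omega> = x0 i \<and> v i 0 \<omega> = 0 \<and>
        (\<forall>k. x i (Suc k) \<omega> = x i k \<omega> - \<eta> k *\<^sub>R
                 (\<alpha> k *\<^sub>R (\<Sum>j\<in>UNIV. L $ i $ j *\<^sub>R x j k \<omega>) + \<beta> k *\<^sub>R v i k \<omega>
                  + g i (x i k \<omega>) (\<xi> i k \<omega>)) \<and>
             v i (Suc k) \<omega> = v i k \<omega> + (\<eta> k * \<beta> k) *\<^sub>R (\<Sum>j\<in>UNIV. L $ i $ j *\<^sub>R x j k \<omega>)))"

definition lyapunov0 ::
  "real^'n^'n \<Rightarrow> ('n::finite \<Rightarrow> real^'p::finite \<Rightarrow> real) \<Rightarrow> real \<Rightarrow> real \<Rightarrow> real \<Rightarrow>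
   ('n \<Rightarrow> real^'p) \<Rightarrow> ('n \<Rightarrow> real^'p) \<Rightarrow> real" where
  "lyapunov0 L f fstar \<kappa>1 \<beta> x0 v0 =
     (let xs = stack x0;
          w = stack v0 + (1 / \<beta>) *\<^sub>R stack (\<lambda>i. grad (f i) (mean x0))
      in 1/2 * sqnorm_wrt matrix_K xs
         + 1/2 * sqnorm_wrt (matrix_Q L + \<kappa>1 *\<^sub>R matrix_K) w
         + xs \<bullet> (matrix_K *v w)
         + real CARD('n) * (avg_cost f (mean x0) - fstar))"

section \<open>Constants\<close>

definition c1 :: "real^'n^'n \<Rightarrow> real" where
  "c1 L = 1 / min_pos_eigenvalue L + 1"

definition eps1 :: "real^'n^'n \<Rightarrow> real \<Rightarrow> real" where
  "eps1 L \<kappa>1 = (\<kappa>1 - 1) * min_pos_eigenvalue L - 1"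

definition eps2 :: "real^'n^'n \<Rightarrow> real \<Rightarrow> real" where
  "eps2 L \<kappa>1 = spectral_radius L + (2 * \<kappa>1\<^sup>2 + 1) * spectral_radius (L ** L) + 1"

definition c2 :: "real^'n^'n \<Rightarrow> real \<Rightarrow> real" where
  "c2 L \<kappa>1 = min (eps1 L \<kappa>1 / eps2 L \<kappa>1) (1/5)"

definition kappa3 :: "real^'n^'n \<Rightarrow> real \<Rightarrow> real" where
  "kappa3 L \<kappa>1 = 1 / min_pos_eigenvalue L + \<kappa>1 + 1"

definition kappa4 :: "real^'n^'n \<Rightarrow> real \<Rightarrow> real" where
  "kappa4 L \<kappa>1 = 1 / min_pos_eigenvalue L + \<kappa>1 + 3/2"

definition kappa5 :: "real^'n^'n \<Rightarrow> real \<Rightarrow> real" where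
  "kappa5 L \<kappa>1 = (\<kappa>1 + 1) / 2 + 1 / (2 * min_pos_eigenvalue L)"

definition kappa6 :: "real^'n^'n \<Rightarrow> real \<Rightarrow> real" where
  "kappa6 L \<kappa>1 = min (1 / (2 * spectral_radius L)) ((\<kappa>1 - 1) / (2 * \<kappa>1))"

definition eps3 :: "real^'n^'n \<Rightarrow> real \<Rightarrow> real \<Rightarrow> real" where
  "eps3 L \<kappa>1 \<kappa>2 = eps1 L \<kappa>1 * \<kappa>2 - eps2 L \<kappa>1 * \<kappa>2\<^sup>2"

definition eps4 :: "real \<Rightarrow> real" where
  "eps4 \<kappa>2 = 1/2 * (\<kappa>2 - 5 * \<kappa>2\<^sup>2)"

definition eps6 :: "real^'n^'n \<Rightarrow> real \<Rightarrow> real \<Rightarrow> real" where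
  "eps6 L Lf \<kappa>1 = max (1/2 * (2 + 3 * Lf\<^sup>2)) (kappa3 L \<kappa>1)"

definition eps5 :: "real^'n^'n \<Rightarrow> real \<Rightarrow> real \<Rightarrow> real \<Rightarrow> real" where
  "eps5 L Lf \<kappa>1 \<kappa>2 =
     Lf + 1 / (\<kappa>2 * eps6 L Lf \<kappa>1) * kappa3 L \<kappa>1 * Lf\<^sup>2
        + 2 / (eps6 L Lf \<kappa>1)\<^sup>2 * kappa4 L \<kappa>1 * Lf\<^sup>2"

definition breve_eps6 :: "real^'n^'n \<Rightarrow> real \<Rightarrow> real \<Rightarrow> real" where
  "breve_eps6 L Lf \<kappa>1 = max (1 + 3 * Lf\<^sup>2) (kappa3 L \<kappa>1)"

definition breve_c0 :: "real^'n^'n \<Rightarrow> real \<Rightarrow> real \<Rightarrow> real \<Rightarrow> real" where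
  "breve_c0 L Lf \<kappa>1 \<kappa>2 = max (4 * \<kappa>2 * eps5 L Lf \<kappa>1 \<kappa>2) (breve_eps6 L Lf \<kappa>1)"

definition eps :: "real^'n^'n \<Rightarrow> real \<Rightarrow> real \<Rightarrow> real \<Rightarrow> real \<Rightarrow> real" where
  "eps L \<nu> \<kappa>1 \<kappa>2 \<eta> =
     1 / kappa5 L \<kappa>1 * min (eps3 L \<kappa>1 \<kappa>2 / \<eta>) (min (eps4 \<kappa>2 / \<eta>) (\<nu> / 2))"

definition c4 :: "real^'n^'n \<Rightarrow> real \<Rightarrow> real \<Rightarrow> real" where
  "c4 L \<kappa>1 W0 = W0 / (real CARD('n) * kappa6 L \<kappa>1)"

definition breve_c5 :: "real^'n^'n \<Rightarrow> real \<Rightarrow> real \<Rightarrow> real \<Rightarrow> real \<Rightarrow> real" where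
  "breve_c5 L \<nu> \<kappa>1 \<kappa>2 \<eta> = (3 + 5 * \<eta>) / (eps L \<nu> \<kappa>1 \<kappa>2 \<eta> * kappa6 L \<kappa>1)"

end

theory Submission
  imports Defs
begin

text \<open>
  Write \<open>e\<close> for the deviations of the primal variables from their mean and \<open>w\<close> for the centred dual
  variables shifted by \<open>1/\<beta>\<close> times the gradients at the mean. The Lyapunov function is a quadratic energy
  in \<open>(e, w)\<close> plus the optimality gap at the mean; its weight \<open>L\<^sup>+\<close> and its cross term make
  all indefinite first-order terms of one iteration cancel. What remains is negative in \<open>|e|\<^sup>2\<close> and
  \<open>|w|\<^sup>2\<close>, and Young's inequality absorbs the second-order terms and the drift of the gradients.
  No unbiasedness is needed because the descent of the gap is expanded as
  \<open>-2\<langle>a, c\<rangle> = |a - c|\<^sup>2 - |a|\<^sup>2 - |c|\<^sup>2\<close>, where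
  \<open>-|c|\<^sup>2\<close> (\<open>c\<close> the averaged stochastic gradient) pays for the drift. This gives a pathwise contraction
  with the squared gradient noise as the only error. The iterates up to time \<open>k\<close> depend only on the
  samples before time \<open>k\<close>, so by Fubini the expected squared noise at time \<open>k\<close> is at most
  \<open>n \<sigma>\<^sup>2\<close>.
\<close>

section \<open>Spectra of real symmetric matrices\<close>

text \<open>With biased gradients the noise has no vanishing cross term, so its square is charged in
  full at each step and the error floor is its weight divided by the contraction rate. The duals
  keep mean 0, as the columns of \<open>L\<close> sum to 0; hence the mean of the iterates makes a
  plain averaged gradient step, and gap and energy are coupled only through gradients. The gradient
  error, measured against the gradients at the mean, splits by Pythagoras into a centred part,
  charged to the energy, and a mean part, charged to the gap; one bound by noise plus L_f^2 |e|^2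
  covers both. The rate is a minimum of three because |e|^2, |w|^2 and the gap each decrease at
  their own rate; \<open>kappa5\<close> converts the first two into a decrease of the energy. Since
  \<open>h * b = \<kappa>2\<close>, costs of order \<open>h\<close> are weighed against \<kappa>2
  through lower bounds on \<open>b\<close>: 1 + 3 L_f^2 serves the consensus error,
  \<open>kappa3\<close> the dual part. Expectations are taken of a recursive majorant, not of the
  Lyapunov function.\<close>

lemma nonneg_quadratic_imp_linear_zero:
  fixes a c :: real
  assumes "\<And>t. 0 \<le> 2 * t * c + t\<^sup>2 * a"
  shows "c = 0"
proof (rule ccontr)
  assume "c \<noteq> 0"
  have a: "0 \<le> a" using assms[of 1] assms[of "-1"] by simp
  \<comment> \<open>The minimiser of the parabola is \<open>- c / a\<close>; the shift to
    \<open>a + 1\<close> keeps the witness defined for \<open>a = 0\<close>, and the value is still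
    negative.\<close>
  have "2 * (- c / (a + 1)) * c + (- c / (a + 1))\<^sup>2 * a = - (c\<^sup>2 * (a + 2)) / (a + 1)\<^sup>2"
    using a by (simp add: divide_simps power2_eq_square) (simp add: algebra_simps)
  moreover have "0 < c\<^sup>2 * (a + 2) / (a + 1)\<^sup>2"
    using a \<open>c \<noteq> 0\<close> by simp
  ultimately show False using assms[of "- c / (a + 1)"] by simp
qed

text \<open>A maximiser of the Rayleigh quotient on the unit sphere of \<open>S\<close> is an
  eigenvector: \<open>l - T\<close> is positive semidefinite on \<open>S\<close> and its form
  vanishes at \<open>x\<close>. Invariance of \<open>S\<close> makes the residual \<open>z\<close>
  an admissible direction of perturbation.\<close>

lemma selfadjoint_eigenvector_exists:
  fixes T :: "'a::euclidean_space \<Rightarrow> 'a"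
  assumes T: "linear T" and sa: "\<And>x y. T x \<bullet> y = x \<bullet> T y"
    and S: "subspace S" and inv: "\<And>x. x \<in> S \<Longrightarrow> T x \<in> S" and nz: "S \<noteq> {0}"
  obtains x l where "x \<in> S" "norm x = 1" "T x = l *\<^sub>R x"
proof -
  let ?K = "S \<inter> sphere 0 1"
  have "compact ?K" using closed_subspace[OF S] by (simp add: closed_Int_compact)
  moreover have "?K \<noteq> {}"
  proof -
    obtain y where "y \<in> S" "y \<noteq> 0" using nz subspace_0[OF S] by blast
    then have "(1 / norm y) *\<^sub>R y \<in> ?K" using subspace_scale[OF S] by simp
    then show ?thesis by blast
  qed
  moreover have "continuous_on ?K (\<lambda>x. x \<bullet> T x)"
    using linear_continuous_on[OF linear_linear[THEN iffD2, OF T]]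
    by (intro continuous_intros) auto
  ultimately obtain x where x: "x \<in> ?K" and mx: "\<And>y. y \<in> ?K \<Longrightarrow> y \<bullet> T y \<le> x \<bullet> T x"
    using continuous_attains_sup[of ?K "\<lambda>x. x \<bullet> T x"] by blast
  define l where "l = x \<bullet> T x"
  have xx: "x \<bullet> x = 1" using x by (simp add: dot_square_norm)
  have psd: "0 \<le> y \<bullet> (l *\<^sub>R y - T y)" if "y \<in> S" for y
  proof (cases "y = 0")
    case False
    then have "(1 / norm y) *\<^sub>R y \<in> ?K" using subspace_scale[OF S] that by simp
    from mx[OF this] have "(y \<bullet> T y) / (norm y)\<^sup>2 \<le> l"
      by (simp add: l_def linear_scale[OF T] power2_eq_square)
    then show ?thesis
      using False by (simp add: divide_simps inner_diff_right dot_square_norm)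
  qed simp
  define z where "z = l *\<^sub>R x - T x"
  have zS: "z \<in> S" using x inv S by (auto simp: z_def subspace_diff subspace_scale)
  \<comment> \<open>Along \<open>x + t *\<^sub>R z\<close> the form has no constant term and, by
    self-adjointness, linear coefficient twice \<open>z \<bullet> z\<close>.\<close>
  have "z \<bullet> z = 0"
  proof (rule nonneg_quadratic_imp_linear_zero)
    fix t :: real
    have "0 \<le> (x + t *\<^sub>R z) \<bullet> (l *\<^sub>R (x + t *\<^sub>R z) - T (x + t *\<^sub>R z))"
      using x zS S by (intro psd) (auto simp: subspace_add subspace_scale)
    also have "\<dots> = x \<bullet> (l *\<^sub>R x - T x) + t * (x \<bullet> (l *\<^sub>R z - T z)) + t * (z \<bullet> (l *\<^sub>R x - T x))
        + t\<^sup>2 * (z \<bullet> (l *\<^sub>R z - T z))"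
      by (simp add: linear_add[OF T] linear_scale[OF T] inner_simps power2_eq_square algebra_simps)
    also have "z \<bullet> (l *\<^sub>R x - T x) = z \<bullet> z" by (simp add: z_def)
    also have "x \<bullet> (l *\<^sub>R z - T z) = z \<bullet> z"
    proof -
      have "(l *\<^sub>R x - T x) \<bullet> z = l * (x \<bullet> z) - x \<bullet> T z"
        using sa[of x z] by (simp add: inner_diff_left)
      then show ?thesis by (simp add: z_def[symmetric] inner_diff_right)
    qed
    also have "x \<bullet> (l *\<^sub>R x - T x) = 0" using xx by (simp add: l_def inner_simps)
    finally show "0 \<le> 2 * t * (z \<bullet> z) + t\<^sup>2 * (z \<bullet> (l *\<^sub>R z - T z))" by simp
  qed
  then show ?thesis using that[of x l] x by (simp add: z_def)
qed

text \<open>Induction on the dimension: one unit eigenvector is split off, and self-adjointness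
  keeps its orthogonal complement within \<open>S\<close> invariant.\<close>

lemma selfadjoint_eigenbasis_exists:
  fixes T :: "'a::euclidean_space \<Rightarrow> 'a"
  assumes T: "linear T" and sa: "\<And>x y. T x \<bullet> y = x \<bullet> T y"
    and "subspace S" and "\<And>x. x \<in> S \<Longrightarrow> T x \<in> S"
  shows "\<exists>B\<subseteq>S. pairwise orthogonal B \<and> (\<forall>b\<in>B. norm b = 1 \<and> (\<exists>l. T b = l *\<^sub>R b)) \<and> span B = S"
  using assms(3,4)
proof (induction "dim S" arbitrary: S rule: less_induct)
  case less
  note S = less.prems(1) and inv = less.prems(2)
  show ?case
  proof (cases "S = {0}")
    case True
    then show ?thesis by (intro exI[of _ "{}"]) (auto simp: pairwise_def)
  next
    case False
    obtain x l where x: "x \<in> S" "norm x = 1" "T x = l *\<^sub>R x"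
      using selfadjoint_eigenvector_exists[OF T sa S inv False] by blast
    define S' where "S' = S \<inter> {y. x \<bullet> y = 0}"
    have S': "subspace S'" unfolding S'_def
      by (intro subspace_inter S subspace_hyperplane)
    have inv': "T y \<in> S'" if "y \<in> S'" for y
      using that inv x by (auto simp: S'_def sa[symmetric])
    have "S' \<subseteq> S" by (auto simp: S'_def)
    moreover have "x \<notin> S'" using x by (auto simp: S'_def)
    ultimately have "dim S' < dim S"
      using x S S' by (intro dim_psubset) (auto simp: span_eq_iff[THEN iffD2])
    from less.hyps[OF this S' inv'] obtain B where B: "B \<subseteq> S'" "pairwise orthogonal B"
      "\<forall>b\<in>B. norm b = 1 \<and> (\<exists>l. T b = l *\<^sub>R b)" "span B = S'" by blast
    have "span (insert x B) = S"
    proof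
      show "span (insert x B) \<subseteq> S"
        using B(1) x \<open>S' \<subseteq> S\<close> S by (intro span_minimal) auto
      show "S \<subseteq> span (insert x B)"
      proof
        fix y assume y: "y \<in> S"
        have "y - (x \<bullet> y) *\<^sub>R x \<in> S'"
          using y x S by (auto simp: S'_def subspace_diff subspace_scale inner_simps dot_square_norm)
        then show "y \<in> span (insert x B)"
          unfolding span_insert B(4) by blast
      qed
    qed
    moreover have "pairwise orthogonal (insert x B)"
      using B(1,2) by (auto simp: pairwise_insert orthogonal_def S'_def inner_commute)
    ultimately show ?thesis using B x \<open>S' \<subseteq> S\<close>
      by (intro exI[of _ "insert x B"]) auto
  qed
qed

text \<open>\<open>spectral_radius\<close> and \<open>min_pos_eigenvalue\<close> are a
  \<open>Max\<close> and a \<open>Min\<close>, which are informative only on finite sets. An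
  eigenvector cannot be orthogonal to a whole eigenbasis, and its eigenvalue agrees with that of any
  basis vector it is not orthogonal to.\<close>

lemma finite_selfadjoint_eigenvalues:
  fixes T :: "'a::euclidean_space \<Rightarrow> 'a"
  assumes T: "linear T" and sa: "\<And>x y. T x \<bullet> y = x \<bullet> T y"
  shows "finite {l. \<exists>x. x \<noteq> 0 \<and> T x = l *\<^sub>R x}"
proof -
  obtain B where B: "pairwise orthogonal B" "\<forall>b\<in>B. norm b = 1 \<and> (\<exists>l. T b = l *\<^sub>R b)"
    "span B = UNIV"
    using selfadjoint_eigenbasis_exists[OF T sa subspace_UNIV] by auto
  have "0 \<notin> B" using B by auto
  then have fin: "finite B"
    using pairwise_orthogonal_independent[OF B(1)] independent_imp_finite by blast
  have "{l. \<exists>x. x \<noteq> 0 \<and> T x = l *\<^sub>R x} \<subseteq> (\<lambda>b. b \<bullet> T b) ` B"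
  proof safe
    fix l x assume x: "x \<noteq> 0" "T x = l *\<^sub>R x"
    have "\<not> (\<forall>b\<in>B. x \<bullet> b = 0)"
    proof
      assume "\<forall>b\<in>B. x \<bullet> b = 0"
      then have "orthogonal x y" if "y \<in> span B" for y
        using orthogonal_to_span[OF that, of x] by (auto simp: orthogonal_def)
      then have "x \<bullet> x = 0" using B by (auto simp: orthogonal_def)
      with x show False by simp
    qed
    then obtain b where b: "b \<in> B" "x \<bullet> b \<noteq> 0" by blast
    obtain m where m: "T b = m *\<^sub>R b" using B b by blast
    have "l * (x \<bullet> b) = m * (x \<bullet> b)" using sa[of x b] x m by simp
    then have "l = b \<bullet> T b" using b m B(2) by (auto simp: dot_square_norm)
    then show "l \<in> (\<lambda>b. b \<bullet> T b) ` B" using b by blast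
  qed
  then show ?thesis using fin finite_subset by blast
qed

lemma matrix_vector_mult_inner_sym:
  fixes A :: "real^'n^'n"
  assumes "transpose A = A"
  shows "(A *v x) \<bullet> y = x \<bullet> (A *v y)"
  using dot_lmul_matrix[of x A y] assms
  by (metis transpose_matrix_vector)

text \<open>For a complex eigenvector a + i b, symmetry applied to the real and imaginary parts of
  the eigenvalue equation gives Im c (|a|^2 + |b|^2) = 0; whichever of a, b is nonzero is then a
  real eigenvector.\<close>

lemma spectrum_symmetric:
  fixes A :: "real^'n^'n"
  assumes sym: "transpose A = A"
  shows "spectrum A = complex_of_real ` {l. \<exists>x. x \<noteq> 0 \<and> A *v x = l *\<^sub>R x}"
proof safe
  fix c assume "c \<in> spectrum A"
  then obtain u :: "complex^'n" where u: "u \<noteq> 0"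
    and Au: "(\<chi> i j. complex_of_real (A $ i $ j)) *v u = c *s u"
    by (auto simp: spectrum_def)
  define a b where "a = (\<chi> i. Re (u $ i))" and "b = (\<chi> i. Im (u $ i))"
  have eq: "(\<Sum>j\<in>UNIV. complex_of_real (A $ i $ j) * u $ j) = c * u $ i" for i
    using Au by (simp add: vec_eq_iff matrix_vector_mult_def)
  have Aa: "A *v a = Re c *\<^sub>R a - Im c *\<^sub>R b"
    using eq[THEN arg_cong[of _ _ Re]]
    by (simp add: vec_eq_iff matrix_vector_mult_def a_def b_def)
  have Ab: "A *v b = Re c *\<^sub>R b + Im c *\<^sub>R a"
    using eq[THEN arg_cong[of _ _ Im]]
    by (simp add: vec_eq_iff matrix_vector_mult_def a_def b_def algebra_simps)
  have "Im c * (a \<bullet> a + b \<bullet> b) = 0"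
    using matrix_vector_mult_inner_sym[OF sym, of a b] unfolding Aa Ab
    by (simp add: inner_simps algebra_simps)
  moreover have "a \<noteq> 0 \<or> b \<noteq> 0"
    using u by (auto simp: a_def b_def vec_eq_iff complex_eq_iff)
  then have "a \<bullet> a + b \<bullet> b \<noteq> 0"
    by (metis add_nonneg_eq_0_iff inner_eq_zero_iff inner_ge_zero)
  ultimately have "Im c = 0" by simp
  then have "c = complex_of_real (Re c)" by (simp add: complex_eq_iff)
  moreover have "\<exists>x. x \<noteq> 0 \<and> A *v x = Re c *\<^sub>R x"
    using Aa Ab \<open>Im c = 0\<close> \<open>a \<noteq> 0 \<or> b \<noteq> 0\<close> by auto
  ultimately show "c \<in> complex_of_real ` {l. \<exists>x. x \<noteq> 0 \<and> A *v x = l *\<^sub>R x}" by blast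
next
  fix l and x :: "real^'n" assume x: "x \<noteq> 0" "A *v x = l *\<^sub>R x"
  let ?u = "\<chi> i. complex_of_real (x $ i)"
  have "(\<Sum>j\<in>UNIV. A $ i $ j * x $ j) = l * x $ i" for i
    using x by (simp add: vec_eq_iff matrix_vector_mult_def)
  then have "(\<chi> i j. complex_of_real (A $ i $ j)) *v ?u = complex_of_real l *s ?u"
    by (simp add: vec_eq_iff matrix_vector_mult_def flip: of_real_mult of_real_sum)
  moreover have "?u \<noteq> 0" using x by (auto simp: vec_eq_iff)
  ultimately show "complex_of_real l \<in> spectrum A" by (auto simp: spectrum_def)
qed

lemma finite_spectrum_symmetric:
  fixes A :: "real^'n^'n"
  assumes "transpose A = A"
  shows "finite (spectrum A)"
  unfolding spectrum_symmetric[OF assms]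
  using finite_selfadjoint_eigenvalues[OF matrix_vector_mul_linear matrix_vector_mult_inner_sym[OF assms]]
  by blast

lemma eigenvalue_le_spectral_radius:
  fixes A :: "real^'n^'n"
  assumes "transpose A = A" "x \<noteq> 0" "A *v x = l *\<^sub>R x"
  shows "\<bar>l\<bar> \<le> spectral_radius A"
proof -
  have "complex_of_real l \<in> spectrum A"
    unfolding spectrum_symmetric[OF assms(1)] using assms by blast
  then have "cmod (complex_of_real l) \<le> spectral_radius A"
    unfolding spectral_radius_def
    by (intro Max_ge finite_imageI imageI finite_spectrum_symmetric[OF assms(1)])
  then show ?thesis by simp
qed

lemma
  fixes A :: "real^'n^'n"
  assumes A: "transpose A = A" and x: "x \<noteq> 0" "A *v x = l *\<^sub>R x" and "0 < l"
  shows min_pos_eigenvalue_le: "min_pos_eigenvalue A \<le> l"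
    and min_pos_eigenvalue_pos: "0 < min_pos_eigenvalue A"
proof -
  let ?S = "{r. 0 < r \<and> complex_of_real r \<in> spectrum A}"
  have "finite ?S"
    by (rule finite_subset[of _ "Re ` spectrum A"])
      (force simp: image_iff, simp add: finite_spectrum_symmetric[OF A])
  moreover have l: "l \<in> ?S"
    unfolding spectrum_symmetric[OF A] using x \<open>0 < l\<close> by blast
  ultimately show "min_pos_eigenvalue A \<le> l" unfolding min_pos_eigenvalue_def by simp
  have "Min ?S \<in> ?S" using \<open>finite ?S\<close> l by (intro Min_in) auto
  then show "0 < min_pos_eigenvalue A" unfolding min_pos_eigenvalue_def by simp
qed

section \<open>Laplacians of connected graphs\<close>

lemma weighted_laplacian_transpose:
  "weighted_laplacian E L \<Longrightarrow> transpose L = L"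
  by (simp add: weighted_laplacian_def transpose_def vec_eq_iff)

lemma weighted_laplacian_row_sum:
  assumes "weighted_laplacian E L"
  shows "(\<Sum>j\<in>UNIV. L $ i $ j) = 0"
  using assms sum.remove[of UNIV i "\<lambda>j. L $ i $ j"] by (simp add: weighted_laplacian_def)

lemma weighted_laplacian_kills_ones:
  "weighted_laplacian E L \<Longrightarrow> L *v 1 = 0"
  by (simp add: matrix_vector_mult_def vec_eq_iff weighted_laplacian_row_sum)

text \<open>When the squares are expanded, the pure square terms drop out because rows and columns
  sum to 0. Semidefiniteness and the kernel are read off from this sum over edges.\<close>

lemma weighted_laplacian_quadratic_form:
  assumes "weighted_laplacian E L"
  shows "x \<bullet> (L *v x) = (\<Sum>i\<in>UNIV. \<Sum>j\<in>UNIV. - (L $ i $ j) * (x $ i - x $ j)\<^sup>2) / 2"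
proof -
  note rs = weighted_laplacian_row_sum[OF assms]
  have sym: "L $ i $ j = L $ j $ i" for i j using assms by (simp add: weighted_laplacian_def)
  have cs: "(\<Sum>i\<in>UNIV. L $ i $ j) = 0" for j using rs[of j] by (subst sym)
  have 1: "(\<Sum>i\<in>UNIV. \<Sum>j\<in>UNIV. L $ i $ j * (x $ i)\<^sup>2) = 0"
    by (simp add: rs flip: sum_distrib_right)
  have 2: "(\<Sum>i\<in>UNIV. \<Sum>j\<in>UNIV. L $ i $ j * (x $ j)\<^sup>2) = 0"
    by (subst sum.swap) (simp add: cs flip: sum_distrib_right)
  have "(\<Sum>i\<in>UNIV. \<Sum>j\<in>UNIV. - (L $ i $ j) * (x $ i - x $ j)\<^sup>2)
      = (\<Sum>i\<in>UNIV. \<Sum>j\<in>UNIV. 2 * (x $ i * (L $ i $ j * x $ j)) - L $ i $ j * (x $ i)\<^sup>2 - L $ i $ j * (x $ j)\<^sup>2)"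
    by (intro sum.cong refl) (simp add: power2_eq_square algebra_simps)
  also have "\<dots> = 2 * (x \<bullet> (L *v x))"
    by (simp add: sum_subtractf 1 2 inner_vec_def matrix_vector_mult_def sum_distrib_left)
  finally show ?thesis by simp
qed

lemma weighted_laplacian_form_term_nonneg:
  assumes "weighted_laplacian E L"
  shows "0 \<le> - (L $ i $ j) * ((x $ i - x $ j)\<^sup>2 :: real)"
proof (cases "i = j")
  case False
  then have "L $ i $ j \<le> 0" using assms unfolding weighted_laplacian_def
    by (metis order.strict_implies_order order_refl)
  then show ?thesis by (simp add: mult_nonpos_nonneg)
qed simp

lemma weighted_laplacian_psd:
  assumes "weighted_laplacian E L"
  shows "0 \<le> x \<bullet> (L *v x)"
  unfolding weighted_laplacian_quadratic_form[OF assms]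
  by (intro divide_nonneg_pos sum_nonneg weighted_laplacian_form_term_nonneg[OF assms]) simp

text \<open>A vanishing sum of nonnegative edge terms makes \<open>x\<close> agree across each edge,
  hence along paths.\<close>

lemma connected_laplacian_kernel:
  assumes L: "weighted_laplacian E L" and E: "connected_graph E" and 0: "L *v x = 0"
  shows "x $ i = x $ j"
proof -
  have "(\<Sum>i\<in>UNIV. \<Sum>j\<in>UNIV. - (L $ i $ j) * (x $ i - x $ j)\<^sup>2) = 0"
    using weighted_laplacian_quadratic_form[OF L, of x] 0 by simp
  then have z: "- (L $ i $ j) * (x $ i - x $ j)\<^sup>2 = 0" for i j
    using weighted_laplacian_form_term_nonneg[OF L]
    by (simp add: sum_nonneg_eq_0_iff sum_nonneg)
  have edge: "x $ i = x $ j" if "(i, j) \<in> E" for i j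
  proof (cases "i = j")
    case False
    then have "L $ i $ j < 0" using that L unfolding weighted_laplacian_def by metis
    then show ?thesis using z[of i j] by simp
  qed simp
  have "(i, j) \<in> E\<^sup>*" using E by (simp add: connected_graph_def)
  then show ?thesis by (induction rule: rtrancl_induct) (auto dest: edge)
qed

text \<open>The hyperplane orthogonal to \<open>1\<close> is invariant and has dimension n - 1,
  which matches the index set. This existence is what makes the \<open>SOME\<close> in
  \<open>laplacian_pinv\<close> denote a pseudoinverse.\<close>

lemma nonzero_eigensystem_exists:
  fixes L :: "real^'n^'n"
  assumes L: "weighted_laplacian E L" and E: "connected_graph E"
  shows "\<exists>lam r. nonzero_eigensystem L lam r"
proof -
  note tr = weighted_laplacian_transpose[OF L]
  define S where "S = {x :: real^'n. 1 \<bullet> x = 0}"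
  have S: "subspace S" unfolding S_def by (rule subspace_hyperplane)
  have inv: "L *v x \<in> S" for x
    using matrix_vector_mult_inner_sym[OF tr, of 1 x]
    by (simp add: S_def weighted_laplacian_kills_ones[OF L])
  have "(1 :: real^'n) \<noteq> 0" by (simp add: vec_eq_iff)
  then have dS: "dim S = CARD('n) - 1"
    unfolding S_def by (subst dim_hyperplane) simp_all
  obtain B where B: "B \<subseteq> S" "pairwise orthogonal B"
    "\<forall>b\<in>B. norm b = 1 \<and> (\<exists>l. L *v b = l *\<^sub>R b)" "span B = S"
    using selfadjoint_eigenbasis_exists[OF matrix_vector_mul_linear
        matrix_vector_mult_inner_sym[OF tr] S inv] by blast
  have ind: "independent B"
    using B by (intro pairwise_orthogonal_independent) auto
  have "card B = CARD('n) - 1"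
    using dim_span_eq_card_independent[OF ind] B(4) dS by simp
  moreover have "finite B" using ind independent_imp_finite by blast
  ultimately obtain r where r: "bij_betw r {2..CARD('n)} B"
    using finite_same_card_bij[of "{2..CARD('n)}" B] by auto
  define lam where "lam m = (SOME l. L *v r m = l *\<^sub>R r m)" for m
  have rB: "r m \<in> B" if "m \<in> {2..CARD('n)}" for m using r that by (auto simp: bij_betw_def)
  have "L *v r m = lam m *\<^sub>R r m" if "m \<in> {2..CARD('n)}" for m
    unfolding lam_def using B(3) rB[OF that] by (metis (mono_tags, lifting) someI_ex)
  moreover have "lam m \<noteq> 0" if m: "m \<in> {2..CARD('n)}" for m
  proof
    assume "lam m = 0"
    then have const: "r m $ i = r m $ j" for i j
      using connected_laplacian_kernel[OF L E, of "r m"] calculation[OF m] by simp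
    \<comment> \<open>\<open>undefined\<close> is just some vertex: all coordinates of
      \<open>r m\<close> agree, and a constant vector orthogonal to \<open>1\<close> is
      zero.\<close>
    define c where "c = r m $ undefined"
    have "r m = c *\<^sub>R 1" using const by (simp add: vec_eq_iff c_def)
    moreover have "1 \<bullet> r m = 0" using rB[OF m] B(1) by (auto simp: S_def)
    ultimately have "r m \<bullet> r m = 0" by simp
    then show False using B(3) rB[OF m] by (simp add: dot_square_norm)
  qed
  moreover have "r a \<bullet> r b = (if a = b then 1 else 0)"
    if ab: "a \<in> {2..CARD('n)}" "b \<in> {2..CARD('n)}" for a b
  proof (cases "a = b")
    case True
    then show ?thesis using B(3) rB[OF ab(1)] by (simp add: dot_square_norm)
  next
    case False
    then have "r a \<noteq> r b" using r ab by (auto simp: bij_betw_def inj_on_def)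
    then show ?thesis using B(2) rB[OF ab(1)] rB[OF ab(2)] False
      by (auto simp: pairwise_def orthogonal_def)
  qed
  ultimately show ?thesis unfolding nonzero_eigensystem_def by blast
qed

text \<open>Everything about \<^term>\<open>L\<close> and its pseudoinverse is read off from the eigenvector
  coordinates \<^term>\<open>x \<bullet> r m\<close>.\<close>

locale connected_laplacian =
  fixes E :: "('n::finite \<times> 'n) set" and L :: "real^'n^'n" and lam :: "nat \<Rightarrow> real" and r :: "nat \<Rightarrow> real^'n"
  assumes L: "weighted_laplacian E L" and E: "connected_graph E" and n2: "CARD('n) \<ge> 2"
    and es: "nonzero_eigensystem L lam r"
    and pinv: "laplacian_pinv L = (\<chi> i j. \<Sum>m = 2..CARD('n). r m $ i * inverse (lam m) * r m $ j)"
begin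

abbreviation "P \<equiv> laplacian_pinv L"
abbreviation "\<rho>2 \<equiv> min_pos_eigenvalue L"
abbreviation "\<rho> \<equiv> spectral_radius L"
abbreviation "\<rho>sq \<equiv> spectral_radius (L ** L)"

lemma tr: "transpose L = L" by (rule weighted_laplacian_transpose[OF L])

lemma eig: "m \<in> {2..CARD('n)} \<Longrightarrow> L *v r m = lam m *\<^sub>R r m" and lam_nz: "m \<in> {2..CARD('n)} \<Longrightarrow> lam m \<noteq> 0"
  using es by (auto simp: nonzero_eigensystem_def)

lemma ortho: "a \<in> {2..CARD('n)} \<Longrightarrow> b \<in> {2..CARD('n)} \<Longrightarrow> r a \<bullet> r b = (if a = b then 1 else 0)"
  using es by (simp add: nonzero_eigensystem_def)

lemma r_nz: "m \<in> {2..CARD('n)} \<Longrightarrow> r m \<noteq> 0"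
  using ortho[of m m] by auto

lemma one_r: "m \<in> {2..CARD('n)} \<Longrightarrow> 1 \<bullet> r m = 0"
  using matrix_vector_mult_inner_sym[OF tr, of 1 "r m"] eig[of m] lam_nz[of m]
  by (simp add: weighted_laplacian_kills_ones[OF L])

lemma lam_pos: "m \<in> {2..CARD('n)} \<Longrightarrow> 0 < lam m"
  using weighted_laplacian_psd[OF L, of "r m"] eig[of m] lam_nz[of m] ortho[of m m]
  by simp

text \<open>By dimension, n - 1 orthonormal vectors orthogonal to \<open>1\<close> span the whole
  hyperplane; the residual \<open>y\<close> lies in their span and is orthogonal to it.\<close>

lemma expansion:
  assumes "1 \<bullet> x = 0"
  shows "x = (\<Sum>m\<in>{2..CARD('n)}. (x \<bullet> r m) *\<^sub>R r m)"
proof -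
  define S where "S = {x :: real^'n. 1 \<bullet> x = 0}"
  have S: "subspace S" unfolding S_def by (rule subspace_hyperplane)
  have inj: "inj_on r {2..CARD('n)}"
  proof (rule inj_onI)
    fix a b assume ab: "a \<in> {2..CARD('n)}" "b \<in> {2..CARD('n)}" "r a = r b"
    show "a = b"
      using ortho[OF ab(1) ab(1)] ortho[OF ab(1,2)] ab(3) by (simp split: if_splits)
  qed
  have ind: "independent (r ` {2..CARD('n)})"
    using ortho r_nz inj
    by (intro pairwise_orthogonal_independent) (auto simp: pairwise_def orthogonal_def)
  have "(1 :: real^'n) \<noteq> 0" by (simp add: vec_eq_iff)
  then have "dim S = CARD('n) - 1"
    unfolding S_def by (subst dim_hyperplane) simp_all
  then have "dim S \<le> card (r ` {2..CARD('n)})" by (simp add: card_image[OF inj])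
  then have span: "S \<subseteq> span (r ` {2..CARD('n)})"
    using one_r ind by (intro card_ge_dim_independent) (auto simp: S_def)
  define y where "y = x - (\<Sum>m\<in>{2..CARD('n)}. (x \<bullet> r m) *\<^sub>R r m)"
  have "1 \<bullet> y = 0" using assms one_r by (simp add: y_def inner_diff_right inner_sum_right)
  then have "y \<in> span (r ` {2..CARD('n)})" using span by (auto simp: S_def)
  moreover have "orthogonal y (r m)" if "m \<in> {2..CARD('n)}" for m
    using that by (simp add: orthogonal_def y_def inner_diff_left inner_sum_left ortho
        if_distrib[of "\<lambda>c. _ * c"] cong: if_cong)
  ultimately have "orthogonal y y"
    using orthogonal_to_span[where S = "r ` {2..CARD('n)}" and x = y and a = y] by blast
  then have "y = 0" by (simp add: orthogonal_self)
  then show ?thesis by (simp add: y_def)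
qed

lemma parseval:
  assumes "1 \<bullet> x = 0"
  shows "x \<bullet> y = (\<Sum>m\<in>{2..CARD('n)}. (x \<bullet> r m) * (y \<bullet> r m))"
  using arg_cong[OF expansion[OF assms], of "\<lambda>z. z \<bullet> y"]
  by (simp add: inner_sum_left inner_commute[of y])

lemma L_coord: "m \<in> {2..CARD('n)} \<Longrightarrow> (L *v x) \<bullet> r m = lam m * (x \<bullet> r m)"
  using matrix_vector_mult_inner_sym[OF tr, of x "r m"] eig[of m] by simp

lemma L_sum: "1 \<bullet> (L *v x) = 0"
  using matrix_vector_mult_inner_sym[OF tr, of 1 x] by (simp add: weighted_laplacian_kills_ones[OF L])

lemma P_mult: "P *v x = (\<Sum>m\<in>{2..CARD('n)}. ((x \<bullet> r m) / lam m) *\<^sub>R r m)"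
proof (rule iffD2[OF vec_eq_iff], intro allI)
  fix i
  have "(P *v x) $ i = (\<Sum>j\<in>UNIV. \<Sum>m\<in>{2..CARD('n)}. r m $ i * inverse (lam m) * r m $ j * x $ j)"
    unfolding pinv by (simp add: matrix_vector_mult_def sum_distrib_right)
  also have "\<dots> = (\<Sum>m\<in>{2..CARD('n)}. \<Sum>j\<in>UNIV. r m $ i * inverse (lam m) * r m $ j * x $ j)"
    by (rule sum.swap)
  also have "\<dots> = (\<Sum>m\<in>{2..CARD('n)}. ((x \<bullet> r m) / lam m) *\<^sub>R r m) $ i"
    by (simp add: inner_vec_def sum_distrib_left sum_distrib_right sum_divide_distrib divide_inverse mult_ac)
  finally show "(P *v x) $ i = (\<Sum>m\<in>{2..CARD('n)}. ((x \<bullet> r m) / lam m) *\<^sub>R r m) $ i" .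
qed

lemma P_coord: "m \<in> {2..CARD('n)} \<Longrightarrow> (P *v x) \<bullet> r m = (x \<bullet> r m) / lam m"
  by (simp add: P_mult inner_sum_left ortho if_distrib[of "\<lambda>c. _ * c"] cong: if_cong)

lemma P_sum: "1 \<bullet> (P *v x) = 0"
  by (simp add: P_mult inner_sum_right one_r)

lemma P_sym: "(P *v x) \<bullet> y = x \<bullet> (P *v y)"
  by (simp add: P_mult inner_sum_left inner_sum_right inner_commute mult_ac)

lemma P_form: "x \<bullet> (P *v x) = (\<Sum>m\<in>{2..CARD('n)}. (x \<bullet> r m)\<^sup>2 / lam m)"
  by (simp add: P_mult inner_sum_right power2_eq_square)

text \<open>Inversion works only off the constants. In the energy step it becomes the hypothesis
  \<open>Q u = e\<close>, with \<open>u\<close> the Laplacian of \<open>e\<close>.\<close>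

lemma P_L: "1 \<bullet> x = 0 \<Longrightarrow> P *v (L *v x) = x"
  using expansion[of x] by (simp add: P_mult L_coord lam_nz cong: sum.cong_simp)

section \<open>Spectral bounds for the Laplacian and its pseudoinverse\<close>

lemma lam_ge: "m \<in> {2..CARD('n)} \<Longrightarrow> \<rho>2 \<le> lam m"
  by (rule min_pos_eigenvalue_le[OF tr r_nz eig lam_pos])

lemma lam_le: "m \<in> {2..CARD('n)} \<Longrightarrow> lam m \<le> \<rho>"
  using eigenvalue_le_spectral_radius[OF tr r_nz eig] by fastforce

lemma lam_sq_le:
  assumes "m \<in> {2..CARD('n)}" shows "(lam m)\<^sup>2 \<le> \<rho>sq"
proof -
  have "transpose (L ** L) = L ** L" by (simp add: matrix_transpose_mul tr)
  moreover have "(L ** L) *v r m = (lam m)\<^sup>2 *\<^sub>R r m"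
    using eig[OF assms]
    by (simp add: matrix_vector_mul_assoc[symmetric] power2_eq_square matrix_vector_mult_scaleR)
  ultimately show ?thesis
    using eigenvalue_le_spectral_radius[of "L ** L" "r m" "(lam m)\<^sup>2"] r_nz[OF assms] by simp
qed

text \<open>Two vertices provide the index 2 and thus a positive eigenvalue; with one vertex
  \<open>Min\<close> would range over the empty set.\<close>

lemma rho2_pos: "0 < \<rho>2"
  using n2 by (intro min_pos_eigenvalue_pos[OF tr r_nz[of 2] eig[of 2] lam_pos[of 2]]) auto

lemma rho_pos: "0 < \<rho>"
  using lam_le[of 2] lam_pos[of 2] n2 by fastforce

lemma rhosq_nonneg: "0 \<le> \<rho>sq"
  using order_trans[OF zero_le_power2 lam_sq_le[of 2]] n2 by simp

text \<open>This bound and the five after it compare Parseval sums term by term, using the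
  eigenvalue bounds above.\<close>

lemma L_form_ge:
  assumes "1 \<bullet> x = 0" shows "\<rho>2 * (x \<bullet> x) \<le> x \<bullet> (L *v x)"
proof -
  have "\<rho>2 * ((x \<bullet> r m) * (x \<bullet> r m)) \<le> (x \<bullet> r m) * ((L *v x) \<bullet> r m)" if "m \<in> {2..CARD('n)}" for m
    using mult_right_mono[OF lam_ge[OF that], of "(x \<bullet> r m) * (x \<bullet> r m)"]
    by (simp add: L_coord[OF that] mult_ac)
  then show ?thesis
    unfolding parseval[OF assms, of x] parseval[OF assms, of "L *v x"] sum_distrib_left
    by (intro sum_mono)
qed

lemma L_form_le:
  assumes "1 \<bullet> x = 0" shows "x \<bullet> (L *v x) \<le> \<rho> * (x \<bullet> x)"
proof -
  have "(x \<bullet> r m) * ((L *v x) \<bullet> r m) \<le> \<rho> * ((x \<bullet> r m) * (x \<bullet> r m))" if "m \<in> {2..CARD('n)}" for m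
    using mult_right_mono[OF lam_le[OF that], of "(x \<bullet> r m) * (x \<bullet> r m)"]
    by (simp add: L_coord[OF that] mult_ac)
  then show ?thesis unfolding parseval[OF assms, of x] parseval[OF assms, of "L *v x"] sum_distrib_left by (intro sum_mono)
qed

lemma L_norm_le:
  assumes "1 \<bullet> x = 0" shows "(L *v x) \<bullet> (L *v x) \<le> \<rho>sq * (x \<bullet> x)"
proof -
  have "((L *v x) \<bullet> r m) * ((L *v x) \<bullet> r m) \<le> \<rho>sq * ((x \<bullet> r m) * (x \<bullet> r m))" if "m \<in> {2..CARD('n)}" for m
    using mult_right_mono[OF lam_sq_le[OF that], of "(x \<bullet> r m) * (x \<bullet> r m)"]
    by (simp add: L_coord[OF that] power2_eq_square mult_ac)
  then show ?thesis unfolding parseval[OF assms, of x] parseval[OF L_sum, of x "L *v x"] sum_distrib_left by (intro sum_mono)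
qed

lemma P_form_ge:
  assumes "1 \<bullet> x = 0" shows "(x \<bullet> x) / \<rho> \<le> x \<bullet> (P *v x)"
proof -
  have "((x \<bullet> r m) * (x \<bullet> r m)) / \<rho> \<le> (x \<bullet> r m)\<^sup>2 / lam m" if "m \<in> {2..CARD('n)}" for m
    using lam_le[OF that] lam_pos[OF that] rho_pos
    by (simp add: power2_eq_square[symmetric] divide_left_mono)
  then show ?thesis unfolding P_form parseval[OF assms, of x] sum_divide_distrib by (intro sum_mono)
qed

lemma P_form_le:
  assumes "1 \<bullet> x = 0" shows "x \<bullet> (P *v x) \<le> (x \<bullet> x) / \<rho>2"
proof -
  have "(x \<bullet> r m)\<^sup>2 / lam m \<le> ((x \<bullet> r m) * (x \<bullet> r m)) / \<rho>2" if "m \<in> {2..CARD('n)}" for m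
    using lam_ge[OF that] lam_pos[OF that] rho2_pos
    by (simp add: power2_eq_square[symmetric] divide_left_mono)
  then show ?thesis unfolding P_form parseval[OF assms, of x] sum_divide_distrib by (intro sum_mono)
qed

lemma P_norm_le:
  assumes "1 \<bullet> x = 0" shows "(P *v x) \<bullet> (P *v x) \<le> (x \<bullet> x) / \<rho>2\<^sup>2"
proof -
  have "((P *v x) \<bullet> r m) * ((P *v x) \<bullet> r m) \<le> ((x \<bullet> r m) * (x \<bullet> r m)) / \<rho>2\<^sup>2" if "m \<in> {2..CARD('n)}" for m
    using lam_ge[OF that] lam_pos[OF that] rho2_pos
    by (simp add: P_coord[OF that] power2_eq_square[symmetric] power_divide divide_left_mono power_mono)
  then show ?thesis unfolding parseval[OF assms, of x] parseval[OF P_sum, of x "P *v x"] sum_divide_distrib by (intro sum_mono)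
qed

end

text \<open>Extracts an eigensystem belonging to the very matrix that \<open>SOME\<close> selected,
  so that \<open>P\<close> can be computed in its coordinates.\<close>

lemma connected_laplacianI:
  fixes L :: "real^'n^'n"
  assumes "weighted_laplacian E L" "connected_graph E" "CARD('n) \<ge> 2"
  obtains lam r where "connected_laplacian E L lam r"
proof -
  have "\<exists>P lam r. nonzero_eigensystem L lam r \<and>
        P = (\<chi> i j. \<Sum>m = 2..CARD('n). r m $ i * inverse (lam m) * r m $ j)"
    using nonzero_eigensystem_exists[OF assms(1,2)] by blast
  from someI_ex[OF this] show ?thesis
    using that assms unfolding laplacian_pinv_def[symmetric] connected_laplacian_def by blast
qed

section \<open>One step of the quadratic energy\<close>

text \<open>The part of the initial Lyapunov value without the gap, over an arbitrary inner product
  space, so that the algebra of one step involves no stacked vectors.\<close>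

definition pd_energy :: "('a::real_inner \<Rightarrow> 'a) \<Rightarrow> real \<Rightarrow> 'a \<Rightarrow> 'a \<Rightarrow> real" where
  "pd_energy Q \<kappa> e w = (e \<bullet> e) / 2 + (w \<bullet> Q w) / 2 + \<kappa> / 2 * (w \<bullet> w) + e \<bullet> w"

text \<open>The cross term \<^term>\<open>e \<bullet> w\<close> and the weight \<^term>\<open>Q\<close> are chosen so that the first-order
  terms in \<^term>\<open>e \<bullet> w\<close> and \<^term>\<open>u \<bullet> w\<close> cancel.\<close>

lemma pd_energy_step_eq:
  fixes e w u q d :: "'a::real_inner"
  assumes Q: "linear Q" and sym: "\<And>x y. Q x \<bullet> y = x \<bullet> Q y" and Qu: "Q u = e"
  shows "pd_energy Q \<kappa>1 (e - \<kappa>2 *\<^sub>R (\<kappa>1 *\<^sub>R u + w) - q) (w + \<kappa>2 *\<^sub>R u + d) - pd_energy Q \<kappa>1 e w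
    = - \<kappa>2 * (\<kappa>1 - 1) * (e \<bullet> u) - \<kappa>2 * (w \<bullet> w) - e \<bullet> q - q \<bullet> w + w \<bullet> (Q d + \<kappa>1 *\<^sub>R d) + e \<bullet> d
      + (((\<kappa>1 - 1) * \<kappa>2) *\<^sub>R u + \<kappa>2 *\<^sub>R w + q - d) \<bullet> (((\<kappa>1 - 1) * \<kappa>2) *\<^sub>R u + \<kappa>2 *\<^sub>R w + q - d) / 2
      + ((\<kappa>2 *\<^sub>R u + d) \<bullet> Q (\<kappa>2 *\<^sub>R u + d)) / 2
      + (\<kappa>1 - 1) / 2 * ((\<kappa>2 *\<^sub>R u + d) \<bullet> (\<kappa>2 *\<^sub>R u + d))"
proof -
  have 1: "u \<bullet> Q x = e \<bullet> x" for x using sym[of u x] Qu by simp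
  have 2: "d \<bullet> Q w = w \<bullet> Q d" using sym[of d w] by (simp add: inner_commute)
  have c: "u \<bullet> e = e \<bullet> u" "w \<bullet> e = e \<bullet> w" "q \<bullet> e = e \<bullet> q" "d \<bullet> e = e \<bullet> d" "w \<bullet> u = u \<bullet> w" "q \<bullet> u = u \<bullet> q"
    "d \<bullet> u = u \<bullet> d" "q \<bullet> w = w \<bullet> q" "d \<bullet> w = w \<bullet> d" "d \<bullet> q = q \<bullet> d" by (rule inner_commute)+
  \<comment> \<open>For increments a of \<open>e\<close> and c of \<open>w\<close>, |a|^2/2 + a.c +
    \<kappa>1 |c|^2/2 = |a + c|^2/2 + (\<kappa>1 - 1) |c|^2/2; this gives the large square and the
    last term on the right.\<close>
  show ?thesis
    unfolding pd_energy_def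
    by (simp add: linear_add[OF Q] linear_scale[OF Q] Qu inner_add_left inner_add_right inner_diff_left
        inner_diff_right 1 2 c) (simp add: field_simps power2_eq_square)
qed

lemma inner_young:
  fixes x y :: "'a::real_inner"
  shows "x \<bullet> y \<le> (x \<bullet> x + y \<bullet> y) / 2"
  using inner_ge_zero[of "x - y"] by (simp add: inner_diff_left inner_diff_right inner_commute[of y x])

lemma inner_young_weighted:
  fixes x y :: "'a::real_inner"
  assumes "0 < h"
  shows "x \<bullet> y \<le> h / 2 * (x \<bullet> x) + (y \<bullet> y) / (2 * h)"
proof -
  have "x \<bullet> y = (sqrt h *\<^sub>R x) \<bullet> ((1 / sqrt h) *\<^sub>R y)" using assms by simp
  also have "\<dots> \<le> ((sqrt h *\<^sub>R x) \<bullet> (sqrt h *\<^sub>R x) + ((1 / sqrt h) *\<^sub>R y) \<bullet> ((1 / sqrt h) *\<^sub>R y)) / 2"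
    by (rule inner_young)
  also have "(sqrt h *\<^sub>R x) \<bullet> (sqrt h *\<^sub>R x) = h * (x \<bullet> x)"
    using assms by (simp flip: mult.assoc)
  also have "((1 / sqrt h) *\<^sub>R y) \<bullet> ((1 / sqrt h) *\<^sub>R y) = (y \<bullet> y) / h"
    using assms by (simp flip: mult.assoc)
  finally show ?thesis by (simp add: add_divide_distrib mult.commute)
qed

lemma inner_add_self_le:
  fixes x y :: "'a::real_inner"
  shows "(x + y) \<bullet> (x + y) \<le> 2 * (x \<bullet> x) + 2 * (y \<bullet> y)"
  using inner_young[of x y] by (simp add: inner_add_left inner_add_right inner_commute[of y x])

lemma inner_add_scaled_self_le:
  fixes x y :: "'a::real_inner"
  shows "(a *\<^sub>R x + b *\<^sub>R y) \<bullet> (a *\<^sub>R x + b *\<^sub>R y) \<le> 2 * a\<^sup>2 * (x \<bullet> x) + 2 * b\<^sup>2 * (y \<bullet> y)"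
  using inner_add_self_le[of "a *\<^sub>R x" "b *\<^sub>R y"] by (simp add: power2_eq_square mult_ac)

text \<open>The error \<open>q\<close> enters with the step size \<open>h\<close>, and
  \<open>d\<close> will itself be of order \<open>h\<close>, so Young with weight \<open>h\<close>
  may put \<open>1 / (2 * h)\<close> on \<open>d\<close>. In \<kappa>3 the part
  \<open>1 / r2 + \<kappa>1\<close> bounds the norm of \<open>Q + \<kappa>1\<close>; the remaining 1
  stems from \<open>q \<bullet> w\<close> in the coefficient of |w|^2 and from
  \<open>e \<bullet> d\<close> in the \<open>1 / (2 * h)\<close> part of that of |d|^2.\<close>

lemma pd_energy_step_le:
  fixes e w u q d :: "'a::real_inner"
  assumes Q: "linear Q" and sym: "\<And>x y. Q x \<bullet> y = x \<bullet> Q y" and Qu: "Q u = e"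
    and psd: "\<And>x. 0 \<le> x \<bullet> Q x"
    and r2: "0 < r2" "r2 * (e \<bullet> e) \<le> e \<bullet> u" and r: "e \<bullet> u \<le> r * (e \<bullet> e)" "u \<bullet> u \<le> rr * (e \<bullet> e)"
    and d: "d \<bullet> Q d \<le> (d \<bullet> d) / r2" "norm (Q d) \<le> norm d / r2"
    and \<kappa>: "1 < \<kappa>1" "0 < \<kappa>2" "0 < h"
    and \<kappa>3: "\<kappa>3 = 1 / r2 + \<kappa>1 + 1"
  shows "pd_energy Q \<kappa>1 (e - \<kappa>2 *\<^sub>R (\<kappa>1 *\<^sub>R u + w) - h *\<^sub>R q) (w + \<kappa>2 *\<^sub>R u + d) \<le> pd_energy Q \<kappa>1 e w
    + (- \<kappa>2 * (\<kappa>1 - 1) * r2 + h + \<kappa>2\<^sup>2 * (r + (2 * (\<kappa>1 - 1)\<^sup>2 + \<kappa>1 - 1) * rr)) * (e \<bullet> e)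
    + (- \<kappa>2 + h / 2 * \<kappa>3 + 2 * \<kappa>2\<^sup>2) * (w \<bullet> w)
    + (h + 2 * h\<^sup>2) * (q \<bullet> q) + (\<kappa>3 / (2 * h) + \<kappa>3) * (d \<bullet> d)"
proof -
  let ?a = "1 / r2 + \<kappa>1"
  let ?m = "\<kappa>2 *\<^sub>R u"
  have b1: "\<kappa>2 * (\<kappa>1 - 1) * (r2 * (e \<bullet> e)) \<le> \<kappa>2 * (\<kappa>1 - 1) * (e \<bullet> u)"
    using r2 \<kappa> by (intro mult_left_mono) auto
  have b2: "- (e \<bullet> (h *\<^sub>R q)) \<le> h / 2 * (e \<bullet> e) + h / 2 * (q \<bullet> q)"
    using mult_left_mono[OF inner_young[of "- e" q], of h] \<kappa> by (simp add: field_simps)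
  have b3: "- ((h *\<^sub>R q) \<bullet> w) \<le> h / 2 * (q \<bullet> q) + h / 2 * (w \<bullet> w)"
    using mult_left_mono[OF inner_young[of "- q" w], of h] \<kappa> by (simp add: field_simps)
  have b4: "w \<bullet> (Q d + \<kappa>1 *\<^sub>R d) \<le> ?a * (h / 2 * (w \<bullet> w) + (d \<bullet> d) / (2 * h))"
  proof -
    have "norm (Q d + \<kappa>1 *\<^sub>R d) \<le> ?a * norm d"
      using norm_triangle_ineq[of "Q d" "\<kappa>1 *\<^sub>R d"] d(2) \<kappa> by (simp add: algebra_simps)
    then have "w \<bullet> (Q d + \<kappa>1 *\<^sub>R d) \<le> norm w * (?a * norm d)"
      using norm_cauchy_schwarz mult_left_mono norm_ge_zero order_trans by metis
    also have "\<dots> = ?a * (norm w * norm d)" by simp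
    also have "\<dots> \<le> ?a * (h / 2 * (w \<bullet> w) + (d \<bullet> d) / (2 * h))"
      using inner_young_weighted[OF \<kappa>(3), of "norm w" "norm d"] r2 \<kappa>
      by (intro mult_left_mono) (simp_all add: dot_square_norm power2_eq_square)
    finally show ?thesis .
  qed
  have b5: "e \<bullet> d \<le> h / 2 * (e \<bullet> e) + (d \<bullet> d) / (2 * h)" by (rule inner_young_weighted[OF \<kappa>(3)])
  let ?s = "((\<kappa>1 - 1) * \<kappa>2) *\<^sub>R u + \<kappa>2 *\<^sub>R w + h *\<^sub>R q - d"
  have b6: "(?s \<bullet> ?s) / 2 \<le> 2 * (\<kappa>1 - 1)\<^sup>2 * \<kappa>2\<^sup>2 * (u \<bullet> u) + 2 * \<kappa>2\<^sup>2 * (w \<bullet> w) + 2 * h\<^sup>2 * (q \<bullet> q) + 2 * (d \<bullet> d)"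
  proof -
    \<comment> \<open>Four summands, paired twice, cost a factor 4, which the division by 2 reduces
      to 2.\<close>
    have "?s \<bullet> ?s \<le> 2 * ((((\<kappa>1 - 1) * \<kappa>2) *\<^sub>R u + \<kappa>2 *\<^sub>R w) \<bullet> (((\<kappa>1 - 1) * \<kappa>2) *\<^sub>R u + \<kappa>2 *\<^sub>R w))
        + 2 * ((h *\<^sub>R q - d) \<bullet> (h *\<^sub>R q - d))"
      using inner_add_self_le[of "((\<kappa>1 - 1) * \<kappa>2) *\<^sub>R u + \<kappa>2 *\<^sub>R w" "h *\<^sub>R q - d"]
      by (simp add: add_diff_eq)
    moreover have "(h *\<^sub>R q - d) \<bullet> (h *\<^sub>R q - d) \<le> 2 * h\<^sup>2 * (q \<bullet> q) + 2 * (d \<bullet> d)"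
      using inner_add_self_le[of "h *\<^sub>R q" "- d"] by (simp add: power2_eq_square mult_ac)
    moreover have "(((\<kappa>1 - 1) * \<kappa>2) *\<^sub>R u + \<kappa>2 *\<^sub>R w) \<bullet> (((\<kappa>1 - 1) * \<kappa>2) *\<^sub>R u + \<kappa>2 *\<^sub>R w)
        \<le> 2 * (\<kappa>1 - 1)\<^sup>2 * \<kappa>2\<^sup>2 * (u \<bullet> u) + 2 * \<kappa>2\<^sup>2 * (w \<bullet> w)"
      using inner_add_scaled_self_le[of "(\<kappa>1 - 1) * \<kappa>2" u \<kappa>2 w]
      by (simp only: power_mult_distrib mult.assoc)
    ultimately show ?thesis by linarith
  qed
  have b7: "((?m + d) \<bullet> Q (?m + d)) / 2 \<le> \<kappa>2\<^sup>2 * (e \<bullet> u) + (d \<bullet> d) / r2"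
  proof -
    \<comment> \<open>Parallelogram law for the form of \<open>Q\<close>: dropping the nonnegative
      value at \<open>?m - d\<close> removes the cross term.\<close>
    have "(?m + d) \<bullet> Q (?m + d) + (?m - d) \<bullet> Q (?m - d) = 2 * (?m \<bullet> Q ?m) + 2 * (d \<bullet> Q d)"
      by (simp add: linear_add[OF Q] linear_diff[OF Q] inner_simps)
    moreover have "?m \<bullet> Q ?m = \<kappa>2\<^sup>2 * (e \<bullet> u)"
      by (simp add: linear_scale[OF Q] Qu power2_eq_square inner_commute)
    ultimately show ?thesis using psd[of "?m - d"] d(1) by linarith
  qed
  have b8: "(\<kappa>1 - 1) / 2 * ((?m + d) \<bullet> (?m + d)) \<le> (\<kappa>1 - 1) * \<kappa>2\<^sup>2 * (u \<bullet> u) + (\<kappa>1 - 1) * (d \<bullet> d)"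
  proof -
    have "(\<kappa>1 - 1) / 2 * ((?m + d) \<bullet> (?m + d)) \<le> (\<kappa>1 - 1) / 2 * (2 * (\<kappa>2\<^sup>2 * (u \<bullet> u)) + 2 * (d \<bullet> d))"
      using inner_add_self_le[of ?m d] \<kappa> by (intro mult_left_mono) (auto simp: power2_eq_square mult_ac)
    also have "\<dots> = (\<kappa>1 - 1) * \<kappa>2\<^sup>2 * (u \<bullet> u) + (\<kappa>1 - 1) * (d \<bullet> d)"
      by (simp add: field_simps)
    finally show ?thesis .
  qed
  have b9: "\<kappa>2\<^sup>2 * (e \<bullet> u) \<le> \<kappa>2\<^sup>2 * (r * (e \<bullet> e))" using r by (intro mult_left_mono) auto
  have b10: "(\<kappa>1 - 1) * \<kappa>2\<^sup>2 * (u \<bullet> u) \<le> (\<kappa>1 - 1) * \<kappa>2\<^sup>2 * (rr * (e \<bullet> e))"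
    using r \<kappa> by (intro mult_left_mono) auto
  have b11: "2 * (\<kappa>1 - 1)\<^sup>2 * \<kappa>2\<^sup>2 * (u \<bullet> u) \<le> 2 * (\<kappa>1 - 1)\<^sup>2 * \<kappa>2\<^sup>2 * (rr * (e \<bullet> e))"
    using r \<kappa> by (intro mult_left_mono) auto
  note eq = pd_energy_step_eq[OF Q sym Qu, of \<kappa>1 \<kappa>2 w "h *\<^sub>R q" d]
  have "pd_energy Q \<kappa>1 (e - \<kappa>2 *\<^sub>R (\<kappa>1 *\<^sub>R u + w) - h *\<^sub>R q) (w + \<kappa>2 *\<^sub>R u + d) - pd_energy Q \<kappa>1 e w
    \<le> - (\<kappa>2 * (\<kappa>1 - 1) * (r2 * (e \<bullet> e))) - \<kappa>2 * (w \<bullet> w)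
     + (h / 2 * (e \<bullet> e) + h / 2 * (q \<bullet> q)) + (h / 2 * (q \<bullet> q) + h / 2 * (w \<bullet> w))
     + ?a * (h / 2 * (w \<bullet> w) + (d \<bullet> d) / (2 * h)) + (h / 2 * (e \<bullet> e) + (d \<bullet> d) / (2 * h))
     + (2 * \<kappa>2\<^sup>2 * (w \<bullet> w) + 2 * h\<^sup>2 * (q \<bullet> q) + 2 * (d \<bullet> d))
     + (\<kappa>2\<^sup>2 * (r * (e \<bullet> e)) + (d \<bullet> d) / r2)
     + (\<kappa>1 - 1) * (d \<bullet> d) + (\<kappa>1 - 1) * \<kappa>2\<^sup>2 * (rr * (e \<bullet> e))
     + 2 * (\<kappa>1 - 1)\<^sup>2 * \<kappa>2\<^sup>2 * (rr * (e \<bullet> e))"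
    using b1 b2 b3 b4 b5 b6 b7 b8 b9 b10 b11 unfolding eq minus_mult_left[symmetric] by linarith
  also have "\<dots> = (- \<kappa>2 * (\<kappa>1 - 1) * r2 + h + \<kappa>2\<^sup>2 * (r + (2 * (\<kappa>1 - 1)\<^sup>2 + \<kappa>1 - 1) * rr)) * (e \<bullet> e)
    + (- \<kappa>2 + h / 2 * \<kappa>3 + 2 * \<kappa>2\<^sup>2) * (w \<bullet> w)
    + (h + 2 * h\<^sup>2) * (q \<bullet> q) + (\<kappa>3 / (2 * h) + \<kappa>3) * (d \<bullet> d)"
    unfolding \<kappa>3 by (simp add: algebra_simps add_divide_distrib)
  finally show ?thesis by simp
qed

text \<open>Young with weight \<kappa> spends all of \<kappa>/2 |w|^2 on the cross term, so |w|^2 is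
  controlled by the form of \<open>Q\<close> alone. The two coefficients are the entries of
  \<open>kappa6\<close>.\<close>

lemma pd_energy_ge:
  fixes e w :: "'a::real_inner"
  assumes "(w \<bullet> w) / r \<le> w \<bullet> Q w" "0 < \<kappa>"
  shows "(\<kappa> - 1) / (2 * \<kappa>) * (e \<bullet> e) + 1 / (2 * r) * (w \<bullet> w) \<le> pd_energy Q \<kappa> e w"
proof -
  have "- (e \<bullet> w) \<le> \<kappa> / 2 * (w \<bullet> w) + (e \<bullet> e) / (2 * \<kappa>)"
    using inner_young_weighted[OF assms(2), of "- w" e] by (simp add: inner_commute)
  moreover have "(\<kappa> - 1) / (2 * \<kappa>) * (e \<bullet> e) = (e \<bullet> e) / 2 - (e \<bullet> e) / (2 * \<kappa>)"
    using assms(2) by (simp add: field_simps)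
  ultimately show ?thesis using assms(1) unfolding pd_energy_def by simp
qed

lemma pd_energy_le:
  fixes e w :: "'a::real_inner"
  assumes "w \<bullet> Q w \<le> (w \<bullet> w) / r2"
  shows "pd_energy Q \<kappa> e w \<le> (e \<bullet> e) + ((\<kappa> + 1) / 2 + 1 / (2 * r2)) * (w \<bullet> w)"
  using assms inner_young[of e w] unfolding pd_energy_def
  by (simp add: algebra_simps add_divide_distrib)

section \<open>Stacked vectors\<close>

text \<open>One vector over the agents per coordinate: \<open>kronecker A (mat 1)\<close> acts on
  each slice as \<open>A\<close>, so the spectral bounds carry over by summing over slices.\<close>

definition slice :: "'p::finite \<Rightarrow> real^('n::finite \<times> 'p) \<Rightarrow> real^'n" where
  "slice q z = (\<chi> i. z $ (i, q))"

lemma inner_slices: "y \<bullet> z = (\<Sum>q\<in>UNIV. slice q y \<bullet> slice q z)"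
  for y z :: "real^('n::finite \<times> 'p::finite)"
proof -
  have "y \<bullet> z = (\<Sum>i\<in>UNIV. \<Sum>q\<in>UNIV. y $ (i, q) * z $ (i, q))"
    by (simp add: inner_vec_def sum.cartesian_product flip: UNIV_Times_UNIV)
  also have "\<dots> = (\<Sum>q\<in>UNIV. slice q y \<bullet> slice q z)"
    by (subst sum.swap) (simp add: inner_vec_def slice_def)
  finally show ?thesis .
qed

lemma inner_stack: "stack X \<bullet> stack Y = (\<Sum>i\<in>UNIV. X i \<bullet> Y i)"
  by (simp add: inner_vec_def stack_def sum.cartesian_product case_prod_unfold flip: UNIV_Times_UNIV)

lemma stack_linear:
  "stack X + stack Y = stack (\<lambda>i. X i + Y i)" "stack X - stack Y = stack (\<lambda>i. X i - Y i)"
  "c *\<^sub>R stack X = stack (\<lambda>i. c *\<^sub>R X i)"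
  by (simp_all add: stack_def vec_eq_iff)

lemma kronecker_mat1_nth:
  fixes A :: "real^'n::finite^'m" and z :: "real^('n \<times> 'p::finite)"
  shows "(kronecker A (mat 1) *v z) $ s = (\<Sum>j\<in>UNIV. A $ fst s $ j * z $ (j, snd s))"
proof -
  have "(kronecker A (mat 1) *v z) $ s
      = (\<Sum>j\<in>UNIV. \<Sum>q\<in>UNIV. A $ fst s $ j * mat 1 $ snd s $ q * z $ (j, q))"
    by (simp add: matrix_vector_mult_def kronecker_def sum.cartesian_product case_prod_unfold flip: UNIV_Times_UNIV)
  also have "\<dots> = (\<Sum>j\<in>UNIV. \<Sum>q\<in>UNIV. if q = snd s then A $ fst s $ j * z $ (j, q) else 0)"
    by (intro sum.cong refl) (simp add: mat_def)
  finally show ?thesis by simp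
qed

lemma slice_kronecker: "slice q (kronecker A (mat 1) *v z) = A *v slice q z"
  by (simp add: slice_def vec_eq_iff kronecker_mat1_nth) (simp add: matrix_vector_mult_def)

lemma kronecker_stack:
  "kronecker A (mat 1) *v stack X = stack (\<lambda>i. \<Sum>j\<in>UNIV. A $ i $ j *\<^sub>R X j)"
  by (simp add: vec_eq_iff kronecker_mat1_nth stack_def)

lemma matrix_K_stack: "matrix_K *v stack X = stack (\<lambda>i. X i - mean X)"
proof -
  have "(\<Sum>j\<in>UNIV. (mat 1 - (1 / real CARD('a)) *\<^sub>R (\<chi> i j. (1::real))) $ i $ j *\<^sub>R X j) = X i - mean X" for i
  proof -
    have "(\<Sum>j\<in>UNIV. (mat 1 - (1 / real CARD('a)) *\<^sub>R (\<chi> i j. (1::real))) $ i $ j *\<^sub>R X j)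
        = (\<Sum>j\<in>UNIV. (if j = i then X j else 0) - (1 / real CARD('a)) *\<^sub>R X j)"
      by (intro sum.cong refl) (auto simp: mat_def algebra_simps)
    then show ?thesis by (simp add: sum_subtractf mean_def scaleR_right.sum)
  qed
  then show ?thesis unfolding matrix_K_def kronecker_stack by simp
qed

lemma sum_minus_mean: "(\<Sum>i\<in>UNIV. X i - mean X) = 0"
  by (simp add: sum_subtractf mean_def sum_constant_scaleR)

lemma mean_linear:
  "mean (\<lambda>i. X i + Y i) = mean X + mean Y" "mean (\<lambda>i. X i - Y i) = mean X - mean Y"
  "mean (\<lambda>i. c *\<^sub>R X i) = c *\<^sub>R mean X"
  by (simp_all add: mean_def sum.distrib sum_subtractf algebra_simps flip: scaleR_right.sum)

text \<open>Pythagoras: the cross term vanishes because the deviations sum to 0.\<close>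

lemma sum_inner_minus_mean:
  fixes X :: "'n::finite \<Rightarrow> 'a::real_inner"
  shows "(\<Sum>i\<in>UNIV. X i \<bullet> X i) = (\<Sum>i\<in>UNIV. (X i - mean X) \<bullet> (X i - mean X)) + real CARD('n) * (mean X \<bullet> mean X)"
proof -
  have "X i \<bullet> X i = (X i - mean X) \<bullet> (X i - mean X) + 2 * ((X i - mean X) \<bullet> mean X) + mean X \<bullet> mean X" for i
    by (simp add: inner_diff_left inner_diff_right inner_commute)
  then have "(\<Sum>i\<in>UNIV. X i \<bullet> X i) = (\<Sum>i\<in>UNIV. (X i - mean X) \<bullet> (X i - mean X))
      + 2 * ((\<Sum>i\<in>UNIV. X i - mean X) \<bullet> mean X) + real CARD('n) * (mean X \<bullet> mean X)"
    by (simp add: sum.distrib inner_sum_left sum_distrib_left)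
  then show ?thesis by (simp add: sum_minus_mean)
qed

lemma slice_stack_sum: "1 \<bullet> slice q (stack X) = (\<Sum>i\<in>UNIV. X i) $ q"
  by (simp add: inner_vec_def slice_def stack_def)

text \<open>The range of \<open>matrix_K\<close>, the subspace on which the Laplacian of a connected
  graph is invertible.\<close>

definition centered :: "real^('n::finite \<times> 'p::finite) \<Rightarrow> bool" where
  "centered z \<longleftrightarrow> (\<forall>q. 1 \<bullet> slice q z = 0)"

lemma centered_stack_iff: "centered (stack X) \<longleftrightarrow> (\<Sum>i\<in>UNIV. X i) = 0"
  by (simp add: centered_def slice_stack_sum vec_eq_iff)

context connected_laplacian
begin

lemma kron_L_form_ge:
  fixes z :: "real^('n \<times> 'p::finite)"
  shows "centered z \<Longrightarrow> \<rho>2 * (z \<bullet> z) \<le> z \<bullet> (kronecker L (mat 1) *v z)"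
  unfolding inner_slices[of z] slice_kronecker sum_distrib_left
  by (intro sum_mono L_form_ge) (simp add: centered_def)

lemma kron_L_form_le:
  fixes z :: "real^('n \<times> 'p::finite)"
  shows "centered z \<Longrightarrow> z \<bullet> (kronecker L (mat 1) *v z) \<le> \<rho> * (z \<bullet> z)"
  unfolding inner_slices[of z] slice_kronecker sum_distrib_left
  by (intro sum_mono L_form_le) (simp add: centered_def)

lemma kron_L_norm_le:
  fixes z :: "real^('n \<times> 'p::finite)"
  shows "centered z \<Longrightarrow>
    (kronecker L (mat 1) *v z) \<bullet> (kronecker L (mat 1) *v z) \<le> \<rho>sq * (z \<bullet> z)"
  unfolding inner_slices slice_kronecker sum_distrib_left
  by (intro sum_mono L_norm_le) (simp add: centered_def)

lemma matrix_Q_sym: "(matrix_Q L *v y) \<bullet> z = y \<bullet> (matrix_Q L *v z)"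
  unfolding inner_slices[of _ z] inner_slices[of y] matrix_Q_def slice_kronecker by (simp add: P_sym)

lemma matrix_Q_psd: "0 \<le> z \<bullet> (matrix_Q L *v z)"
  unfolding inner_slices matrix_Q_def slice_kronecker P_form
  by (intro sum_nonneg divide_nonneg_pos lam_pos) auto

lemma matrix_Q_L: "centered z \<Longrightarrow> matrix_Q L *v (kronecker L (mat 1) *v z) = z"
proof -
  assume "centered z"
  then have "slice q (matrix_Q L *v (kronecker L (mat 1) *v z)) = slice q z" for q
    unfolding matrix_Q_def slice_kronecker by (simp add: P_L centered_def)
  then show ?thesis by (auto simp: slice_def vec_eq_iff)
qed

lemma matrix_Q_form_ge:
  fixes z :: "real^('n \<times> 'p::finite)"
  shows "centered z \<Longrightarrow> (z \<bullet> z) / \<rho> \<le> z \<bullet> (matrix_Q L *v z)"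
  unfolding inner_slices[of z] matrix_Q_def slice_kronecker sum_divide_distrib
  by (intro sum_mono P_form_ge) (simp add: centered_def)

lemma matrix_Q_form_le:
  fixes z :: "real^('n \<times> 'p::finite)"
  shows "centered z \<Longrightarrow> z \<bullet> (matrix_Q L *v z) \<le> (z \<bullet> z) / \<rho>2"
  unfolding inner_slices[of z] matrix_Q_def slice_kronecker sum_divide_distrib
  by (intro sum_mono P_form_le) (simp add: centered_def)

lemma matrix_Q_norm_le:
  fixes z :: "real^('n \<times> 'p::finite)"
  assumes "centered z" shows "norm (matrix_Q L *v z) \<le> norm z / \<rho>2"
proof -
  have "(matrix_Q L *v z) \<bullet> (matrix_Q L *v z) \<le> (z \<bullet> z) / \<rho>2\<^sup>2"
    unfolding inner_slices matrix_Q_def slice_kronecker sum_divide_distrib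
    using assms by (intro sum_mono P_norm_le) (simp add: centered_def)
  then have "(norm (matrix_Q L *v z))\<^sup>2 \<le> (norm z / \<rho>2)\<^sup>2"
    by (simp add: dot_square_norm power_divide)
  then show ?thesis by (rule power2_le_imp_le) (use rho2_pos in simp)
qed

lemma matrix_Q_const: "matrix_Q L *v stack (\<lambda>i. c) = 0"
proof -
  have "slice q (stack (\<lambda>i :: 'n. c)) = (c $ q) *\<^sub>R 1" for q
    by (simp add: slice_def stack_def vec_eq_iff)
  then have "slice q (matrix_Q L *v stack (\<lambda>i. c)) = (c $ q) *\<^sub>R (P *v 1)" for q
    unfolding matrix_Q_def slice_kronecker by (simp add: matrix_vector_mult_scaleR)
  moreover have "P *v 1 = 0" by (simp add: P_mult one_r)
  ultimately show ?thesis by (auto simp: slice_def vec_eq_iff)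
qed

text \<open>\<open>lyapunov0\<close> applies \<open>matrix_Q\<close> to an uncentred vector; as
  constant stacks are annihilated, only the centred part counts.\<close>

lemma matrix_Q_form_minus_mean:
  "stack Y \<bullet> (matrix_Q L *v stack Y)
    = stack (\<lambda>i. Y i - mean Y) \<bullet> (matrix_Q L *v stack (\<lambda>i. Y i - mean Y))"
proof -
  have Y: "stack Y = stack (\<lambda>i. Y i - mean Y) + stack (\<lambda>i. mean Y)" by (simp add: stack_linear)
  have "matrix_Q L *v stack Y = matrix_Q L *v stack (\<lambda>i. Y i - mean Y)"
    by (subst Y) (simp add: matrix_vector_right_distrib matrix_Q_const)
  then show ?thesis by (metis matrix_Q_sym)
qed

end

section \<open>Gradients\<close>

text \<open>\<open>grad\<close> is a \<open>THE\<close>: existence is the Riesz representation of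
  the derivative over \<open>Basis\<close>, uniqueness is that of the derivative.\<close>

lemma GDERIV_grad:
  fixes f :: "'a::euclidean_space \<Rightarrow> real"
  assumes "f differentiable (at x)"
  shows "GDERIV f x :> grad f x"
proof -
  obtain F where F: "(f has_derivative F) (at x)" using assms by (auto simp: differentiable_def)
  interpret bounded_linear F using F by (rule has_derivative_bounded_linear)
  define D where "D = (\<Sum>b\<in>Basis. F b *\<^sub>R b)"
  have "F h = h \<bullet> D" for h
  proof -
    have "F h = F (\<Sum>b\<in>Basis. (h \<bullet> b) *\<^sub>R b)" by (simp add: euclidean_representation)
    also have "\<dots> = h \<bullet> D" by (simp add: sum scaleR D_def inner_sum_right mult.commute)
    finally show ?thesis .
  qed
  then have ex: "GDERIV f x :> D" using F unfolding gderiv_def by (metis ext)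
  moreover have "d = D" if "GDERIV f x :> d" for d
    using has_derivative_unique[of f "\<lambda>h. h \<bullet> d" x "\<lambda>h. h \<bullet> D"] that ex unfolding gderiv_def
    by (metis (no_types) inner_commute vector_eq_rdot)
  ultimately show ?thesis unfolding grad_def by (metis theI)
qed

lemma grad_eqI:
  fixes f :: "'a::euclidean_space \<Rightarrow> real"
  assumes "GDERIV f x :> d"
  shows "grad f x = d"
proof -
  have "GDERIV f x :> grad f x"
    using assms by (intro GDERIV_grad) (auto simp: gderiv_def differentiable_def)
  then have "(\<lambda>h. h \<bullet> grad f x) = (\<lambda>h. h \<bullet> d)"
    using has_derivative_unique assms unfolding gderiv_def by blast
  then show ?thesis by (metis vector_eq_rdot inner_commute)
qed

lemma grad_avg_cost:
  fixes f :: "'n::finite \<Rightarrow> 'a::euclidean_space \<Rightarrow> real"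
  assumes "\<And>i y. f i differentiable (at y)"
  shows "GDERIV (avg_cost f) y :> mean (\<lambda>i. grad (f i) y)"
proof -
  have "(f i has_derivative (\<lambda>h. h \<bullet> grad (f i) y)) (at y)" for i
    using GDERIV_grad[OF assms] by (simp add: gderiv_def)
  then have "(avg_cost f has_derivative (\<lambda>h. (1 / real CARD('n)) * (\<Sum>i\<in>UNIV. h \<bullet> grad (f i) y))) (at y)"
    unfolding avg_cost_def by (intro derivative_intros)
  then show ?thesis by (simp add: gderiv_def mean_def inner_sum_right)
qed

text \<open>In place of an integral of the gradient along the segment, \<open>\<phi>\<close>
  subtracts the model from \<open>f\<close> and is shown to be nonincreasing in the segment
  parameter.\<close>

lemma lipschitz_gradient_descent:
  fixes f :: "'a::real_inner \<Rightarrow> real"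
  assumes G: "\<And>x. GDERIV f x :> G x" and lip: "\<And>x y. norm (G x - G y) \<le> C * norm (x - y)"
  shows "f y \<le> f x + G x \<bullet> (y - x) + C / 2 * ((y - x) \<bullet> (y - x))"
proof -
  let ?d = "y - x"
  define \<phi> where "\<phi> t = f (x + t *\<^sub>R ?d) - t * (G x \<bullet> ?d) - C / 2 * t\<^sup>2 * (?d \<bullet> ?d)" for t
  have "\<phi> 1 \<le> \<phi> 0"
  proof (rule DERIV_nonpos_imp_nonincreasing[of 0 1])
    fix t :: real assume t: "0 \<le> t" "t \<le> 1"
    have "((\<lambda>t. f (x + t *\<^sub>R ?d)) has_derivative (\<lambda>s. (s *\<^sub>R ?d) \<bullet> G (x + t *\<^sub>R ?d))) (at t)"
      using G unfolding gderiv_def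
      by (intro has_derivative_compose[where f = "\<lambda>t. x + t *\<^sub>R ?d" and g = f]) (auto intro!: derivative_eq_intros)
    then have "((\<lambda>t. f (x + t *\<^sub>R ?d)) has_real_derivative (?d \<bullet> G (x + t *\<^sub>R ?d))) (at t)"
      by (simp add: has_field_derivative_def mult_commute_abs)
    then have "(\<phi> has_real_derivative (?d \<bullet> G (x + t *\<^sub>R ?d) - G x \<bullet> ?d - C / 2 * (2 * t) * (?d \<bullet> ?d))) (at t)"
      unfolding \<phi>_def by (auto intro!: derivative_eq_intros)
    moreover have "?d \<bullet> G (x + t *\<^sub>R ?d) - G x \<bullet> ?d - C / 2 * (2 * t) * (?d \<bullet> ?d) \<le> 0"
    proof -
      have "?d \<bullet> (G (x + t *\<^sub>R ?d) - G x) \<le> norm ?d * norm (G (x + t *\<^sub>R ?d) - G x)"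
        by (rule norm_cauchy_schwarz)
      also have "\<dots> \<le> norm ?d * (C * norm (t *\<^sub>R ?d))"
        using lip[of "x + t *\<^sub>R ?d" x] by (intro mult_left_mono) auto
      also have "\<dots> = C * t * (?d \<bullet> ?d)" using t by (simp add: dot_square_norm power2_eq_square)
      finally show ?thesis by (simp add: inner_diff_right inner_commute)
    qed
    ultimately show "\<exists>y. (\<phi> has_real_derivative y) (at t) \<and> y \<le> 0" by blast
  qed simp
  then show ?thesis by (simp add: \<phi>_def)
qed

section \<open>Pathwise descent\<close>

text \<open>\<open>matrix_K\<close> is an orthogonal projection, so one application inside a product
  may be duplicated.\<close>

lemma inner_stack_minus_mean:
  "stack X \<bullet> stack (\<lambda>i. Y i - mean Y) = stack (\<lambda>i. X i - mean X) \<bullet> stack (\<lambda>i. Y i - mean Y)"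
proof -
  have "(\<Sum>i\<in>UNIV. mean X \<bullet> (Y i - mean Y)) = 0"
    by (simp add: sum_minus_mean flip: inner_sum_right)
  then show ?thesis by (simp add: inner_stack inner_diff_left sum_subtractf)
qed

text \<open>The deterministic setting; \<open>b\<close> and \<open>h\<close> are the constant values
  of \<beta> and \<eta>.\<close>

locale pd_sgd = connected_laplacian E L lam r
  for E :: "('n::finite \<times> 'n) set" and L :: "real^'n^'n" and lam r +
  fixes f :: "'n \<Rightarrow> real^'p::finite \<Rightarrow> real" and fstar Lf \<nu> \<kappa>1 \<kappa>2 b h :: real
  assumes diff: "\<And>i y. f i differentiable (at y)"
    and minval: "is_min_value (avg_cost f) fstar"
    and Lf_pos: "Lf > 0"
    and smooth: "\<And>i y z. norm (grad (f i) y - grad (f i) z) \<le> Lf * norm (y - z)"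
    and nu_pos: "\<nu> > 0"
    and PL: "\<And>y. 1/2 * (norm (grad (avg_cost f) y))\<^sup>2 \<ge> \<nu> * (avg_cost f y - fstar)"
    and h_def: "h = \<kappa>2 / b"
    and \<kappa>1: "\<kappa>1 > c1 L" and \<kappa>2_pos: "0 < \<kappa>2" and \<kappa>2: "\<kappa>2 < c2 L \<kappa>1"
    and b: "b \<ge> breve_c0 L Lf \<kappa>1 \<kappa>2"
begin

abbreviation "k3 \<equiv> kappa3 L \<kappa>1"
abbreviation "k5 \<equiv> kappa5 L \<kappa>1"
abbreviation "k6 \<equiv> kappa6 L \<kappa>1"
abbreviation "\<epsilon>3 \<equiv> eps3 L \<kappa>1 \<kappa>2"
abbreviation "\<epsilon>4 \<equiv> eps4 \<kappa>2"
abbreviation "\<epsilon> \<equiv> eps L \<nu> \<kappa>1 \<kappa>2 h"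
abbreviation "Q z \<equiv> matrix_Q L *v (z :: real^('n \<times> 'p))"
abbreviation "Lk z \<equiv> kronecker L (mat 1) *v (z :: real^('n \<times> 'p))"


section \<open>Sizes of the constants and coefficient inequalities\<close>

lemma \<kappa>1_gt1: "1 < \<kappa>1"
proof -
  have "0 < 1 / \<rho>2" using rho2_pos by simp
  then show ?thesis using \<kappa>1 unfolding c1_def by linarith
qed

lemma eps2_pos: "0 < eps2 L \<kappa>1"
  using rho_pos rhosq_nonneg by (simp add: eps2_def add_pos_nonneg)

lemma \<kappa>2_lt: "\<kappa>2 < 1 / 5"
  using \<kappa>2 by (simp add: c2_def)

lemma eps3_pos: "0 < \<epsilon>3"
proof -
  have "\<kappa>2 * eps2 L \<kappa>1 < eps1 L \<kappa>1"
    using \<kappa>2 eps2_pos by (simp add: c2_def field_simps)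
  then have "\<kappa>2 * (\<kappa>2 * eps2 L \<kappa>1) < \<kappa>2 * eps1 L \<kappa>1" using \<kappa>2_pos by simp
  then show ?thesis by (simp add: eps3_def power2_eq_square mult_ac)
qed

lemma eps4_pos: "0 < \<epsilon>4"
proof -
  have "\<kappa>2 * (5 * \<kappa>2) < \<kappa>2 * 1" using \<kappa>2_pos \<kappa>2_lt by (intro mult_strict_left_mono) auto
  then show ?thesis by (simp add: eps4_def power2_eq_square mult_ac)
qed

lemma b_ge: "1 + 3 * Lf\<^sup>2 \<le> b" "k3 \<le> b"
  using b by (simp_all add: breve_c0_def breve_eps6_def)

lemma b_ge1: "1 \<le> b"
  using b_ge(1) zero_le_power2[of Lf] by linarith

lemma h_pos: "0 < h" and hb: "h * b = \<kappa>2"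
  using \<kappa>2_pos b_ge1 by (simp_all add: h_def)

lemma h_le: "h < 1 / 5"
proof -
  have "h * 1 \<le> h * b" using h_pos b_ge1 by (intro mult_left_mono) auto
  then show ?thesis using hb \<kappa>2_lt by simp
qed

lemma k3_pos: "0 < k3"
  using rho2_pos \<kappa>1_gt1 by (simp add: kappa3_def add_pos_pos)

lemma k5_ge1: "1 \<le> k5"
proof -
  have "0 \<le> 1 / (2 * \<rho>2)" "1 \<le> (\<kappa>1 + 1) / 2" using rho2_pos \<kappa>1_gt1 by simp_all
  from add_mono[OF this] show ?thesis by (simp add: kappa5_def add.commute)
qed

lemma k6_pos: "0 < k6"
  using rho_pos \<kappa>1_gt1 by (simp add: kappa6_def)

lemma k6_le: "k6 \<le> 1"
proof -
  have "(\<kappa>1 - 1) / (2 * \<kappa>1) \<le> 1" using \<kappa>1_gt1 by (simp add: field_simps)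
  then show ?thesis by (simp add: kappa6_def)
qed

lemma eps_pos: "0 < \<epsilon>"
  using k5_ge1 eps3_pos eps4_pos h_pos nu_pos by (simp add: eps_def)

text \<open>One entry of the minimum for each of |e|^2, |w|^2 and the gap; \<open>k5\<close> is
  carried along because the energy is at most \<open>k5\<close> times |e|^2 + |w|^2.\<close>

lemma h_eps_k5: "h * \<epsilon> * k5 \<le> \<epsilon>3" "h * \<epsilon> * k5 \<le> \<epsilon>4" "h * \<epsilon> * k5 \<le> h * \<nu> / 2"
proof -
  have "h * \<epsilon> * k5 = h * min (\<epsilon>3 / h) (min (\<epsilon>4 / h) (\<nu> / 2))"
    using k5_ge1 by (simp add: eps_def)
  also have "\<dots> = min \<epsilon>3 (min \<epsilon>4 (h * \<nu> / 2))"
    using h_pos by (simp add: min_mult_distrib_left)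
  finally show "h * \<epsilon> * k5 \<le> \<epsilon>3" "h * \<epsilon> * k5 \<le> \<epsilon>4" "h * \<epsilon> * k5 \<le> h * \<nu> / 2" by simp_all
qed

lemma h_eps_le: "h * \<epsilon> \<le> h * \<epsilon> * k5"
  using mult_left_mono[OF k5_ge1, of "h * \<epsilon>"] h_pos eps_pos by simp

lemma h_eps_lt1: "h * \<epsilon> < 1"
proof -
  have "\<epsilon>4 \<le> \<kappa>2 / 2" by (simp add: eps4_def)
  then show ?thesis using h_eps_le h_eps_k5(2) \<kappa>2_lt by linarith
qed

text \<open>The costs of order \<open>h\<close> add up to h (1 + 2 L_f^2 + 4 h L_f^2), which 4h < 1
  bounds by h (1 + 3 L_f^2) \<le> h b = \<kappa>2. This explains 1 + 3 L_f^2 in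
  \<open>breve_eps6\<close> and the -1 in \<open>eps1\<close>; the costs of order \<kappa>2^2 fit
  into \<open>eps2\<close>.\<close>

lemma coeff_consensus:
  "- \<kappa>2 * (\<kappa>1 - 1) * \<rho>2 + h + \<kappa>2\<^sup>2 * (\<rho> + (2 * (\<kappa>1 - 1)\<^sup>2 + \<kappa>1 - 1) * \<rho>sq)
     + (h + 2 * h\<^sup>2) * (2 * Lf\<^sup>2) \<le> - \<epsilon>3"
proof -
  have "h * (1 + 2 * Lf\<^sup>2 + 4 * h * Lf\<^sup>2) \<le> h * b"
  proof (rule mult_left_mono)
    have "4 * h * Lf\<^sup>2 \<le> 1 * Lf\<^sup>2" using h_le by (intro mult_right_mono) auto
    then show "1 + 2 * Lf\<^sup>2 + 4 * h * Lf\<^sup>2 \<le> b" using b_ge(1) by linarith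
  qed (use h_pos in simp)
  then have 1: "h + (h + 2 * h\<^sup>2) * (2 * Lf\<^sup>2) \<le> \<kappa>2"
    unfolding hb by (simp add: algebra_simps power2_eq_square)
  have "2 * (\<kappa>1 - 1)\<^sup>2 + \<kappa>1 - 1 \<le> 2 * \<kappa>1\<^sup>2 + 1"
    using \<kappa>1_gt1 by (simp add: power2_diff)
  then have "(2 * (\<kappa>1 - 1)\<^sup>2 + \<kappa>1 - 1) * \<rho>sq \<le> (2 * \<kappa>1\<^sup>2 + 1) * \<rho>sq"
    using rhosq_nonneg by (rule mult_right_mono)
  then have "\<rho> + (2 * (\<kappa>1 - 1)\<^sup>2 + \<kappa>1 - 1) * \<rho>sq \<le> eps2 L \<kappa>1"
    unfolding eps2_def by linarith
  then have "\<kappa>2\<^sup>2 * (\<rho> + (2 * (\<kappa>1 - 1)\<^sup>2 + \<kappa>1 - 1) * \<rho>sq) \<le> eps2 L \<kappa>1 * \<kappa>2\<^sup>2"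
    by (subst mult.commute) (rule mult_right_mono, simp_all)
  moreover have "eps1 L \<kappa>1 * \<kappa>2 = \<kappa>2 * (\<kappa>1 - 1) * \<rho>2 - \<kappa>2"
    by (simp add: eps1_def algebra_simps)
  ultimately show ?thesis using 1 unfolding eps3_def minus_mult_left[symmetric] by linarith
qed

text \<open>Half of \<open>- \<kappa>2\<close> absorbs \<open>h / 2 * k3\<close>, as
  \<open>k3 \<le> b\<close> gives \<open>h * k3 \<le> \<kappa>2\<close>; the other half leaves room
  for \<open>eps4\<close>.\<close>

lemma coeff_dual: "- \<kappa>2 + h / 2 * k3 + 2 * \<kappa>2\<^sup>2 \<le> - \<epsilon>4"
proof -
  have "h * k3 \<le> h * b" using h_pos b_ge(2) by (intro mult_left_mono) auto
  moreover have "0 \<le> \<kappa>2\<^sup>2" by simp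
  moreover have "\<epsilon>4 = \<kappa>2 / 2 - 5 / 2 * \<kappa>2\<^sup>2" "h / 2 * k3 = h * k3 / 2"
    by (simp_all add: eps4_def)
  ultimately show ?thesis unfolding hb by linarith
qed

text \<open>The left side is the price of the squared averaged gradient: dual drift plus the
  curvature term of the gap. With k3 L_f^2 \<le> b^2/3 and h L_f \<le> 1/5 the shares are 7/30 and
  1/10 of \<open>h\<close>, within the available h/2.\<close>

lemma coeff_mean_gradient: "(k3 / (2 * h) + k3) * ((Lf / b)\<^sup>2 * h\<^sup>2) + h\<^sup>2 * Lf / 2 \<le> h / 2"
proof -
  have "k3 * Lf\<^sup>2 \<le> b * (b / 3)"
    using b_ge b_ge1 k3_pos by (intro mult_mono) auto
  then have 1: "k3 * (Lf / b)\<^sup>2 \<le> 1 / 3"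
    using b_ge1 by (simp add: power_divide field_simps power2_eq_square)
  have "2 * Lf \<le> Lf\<^sup>2 + 1" using zero_le_power2[of "Lf - 1"] unfolding power2_diff by simp
  then have "Lf \<le> b" using b_ge(1) zero_le_power2[of Lf] by linarith
  then have "h * Lf \<le> h * b" using h_pos by (intro mult_left_mono) auto
  then have 2: "h * Lf \<le> 1 / 5" using hb \<kappa>2_lt by simp
  have "(k3 / (2 * h) + k3) * (y * h\<^sup>2) = h * ((1 / 2 + h) * (k3 * y))" for y
    using h_pos by (simp add: field_simps power2_eq_square)
  then have "(k3 / (2 * h) + k3) * ((Lf / b)\<^sup>2 * h\<^sup>2) = h * ((1 / 2 + h) * (k3 * (Lf / b)\<^sup>2))" .
  also have "\<dots> \<le> h * ((1 / 2 + 1 / 5) * (1 / 3))"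
    using h_pos h_le 1 k3_pos by (intro mult_left_mono mult_mono) auto
  finally have "(k3 / (2 * h) + k3) * ((Lf / b)\<^sup>2 * h\<^sup>2) \<le> h * ((1 / 2 + 1 / 5) * (1 / 3))" .
  moreover have "h * (h * Lf) \<le> h * (1 / 5)" using 2 h_pos by (intro mult_left_mono) auto
  then have "h\<^sup>2 * Lf / 2 \<le> h / 10" by (simp add: power2_eq_square mult_ac)
  moreover have "y + z \<le> h / 2" if "y \<le> h * ((1 / 2 + 1 / 5) * (1 / 3))" "z \<le> h / 10" for y z
    using that h_pos by simp
  ultimately show ?thesis by blast
qed

text \<open>Scalar bookkeeping: \<open>e\<close>, \<open>w\<close>, \<open>\<Phi>\<close> stand for
  |e|^2, |w|^2 and the gap; \<open>D\<close> and \<open>H\<close> for the centred and the mean part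
  of the gradient error against the gradients at the mean; \<open>d\<close> for the squared drift in
  the dual variable; \<open>G\<close> for n times the squared averaged stochastic gradient;
  \<open>S\<close> for the squared noise.\<close>

lemma descent_combine:
  assumes V': "V' \<le> V + (- \<kappa>2 * (\<kappa>1 - 1) * \<rho>2 + h + \<kappa>2\<^sup>2 * (\<rho> + (2 * (\<kappa>1 - 1)\<^sup>2 + \<kappa>1 - 1) * \<rho>sq)) * e
      + (- \<kappa>2 + h / 2 * k3 + 2 * \<kappa>2\<^sup>2) * w + (h + 2 * h\<^sup>2) * D + (k3 / (2 * h) + k3) * d"
    and \<Phi>': "\<Phi>' \<le> \<Phi> - h * \<nu> * \<Phi> - h / 2 * G + h / 2 * H + h\<^sup>2 * Lf / 2 * G"
    and D: "D + H \<le> 2 * S + 2 * Lf\<^sup>2 * e" and d: "d \<le> (Lf / b)\<^sup>2 * h\<^sup>2 * G"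
    and V: "V \<le> k5 * (e + w)"
    and nonneg: "0 \<le> e" "0 \<le> w" "0 \<le> H" "0 \<le> G" "0 \<le> S" "0 \<le> \<Phi>"
  shows "V' + \<Phi>' \<le> (1 - h * \<epsilon>) * (V + \<Phi>) + (3 * h + 5 * h\<^sup>2) * S"
proof -
  have h: "0 < h" "0 \<le> h\<^sup>2" using h_pos by auto
  have 1: "(h + 2 * h\<^sup>2) * D + h / 2 * H \<le> (h + 2 * h\<^sup>2) * (2 * S) + (h + 2 * h\<^sup>2) * (2 * Lf\<^sup>2) * e"
  proof -
    \<comment> \<open>The weight of \<open>H\<close> is raised to that of \<open>D\<close>, so that
      the joint bound on \<open>D + H\<close> applies.\<close>
    have "h / 2 * H \<le> (h + 2 * h\<^sup>2) * H" using h nonneg by (intro mult_right_mono) auto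
    then have "(h + 2 * h\<^sup>2) * D + h / 2 * H \<le> (h + 2 * h\<^sup>2) * (D + H)" by (simp add: distrib_left)
    also have "\<dots> \<le> (h + 2 * h\<^sup>2) * (2 * S + 2 * Lf\<^sup>2 * e)" using D h by (intro mult_left_mono) auto
    finally show ?thesis by (simp add: distrib_left mult.assoc)
  qed
  have 2: "(k3 / (2 * h) + k3) * d + h\<^sup>2 * Lf / 2 * G \<le> h / 2 * G"
  proof -
    have "(k3 / (2 * h) + k3) * d \<le> (k3 / (2 * h) + k3) * ((Lf / b)\<^sup>2 * h\<^sup>2 * G)"
      using d h k3_pos by (intro mult_left_mono) auto
    moreover have "((k3 / (2 * h) + k3) * ((Lf / b)\<^sup>2 * h\<^sup>2) + h\<^sup>2 * Lf / 2) * G \<le> h / 2 * G"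
      using nonneg by (intro mult_right_mono coeff_mean_gradient)
    ultimately show ?thesis by (simp only: distrib_right mult.assoc)
  qed
  have 3: "(- \<kappa>2 * (\<kappa>1 - 1) * \<rho>2 + h + \<kappa>2\<^sup>2 * (\<rho> + (2 * (\<kappa>1 - 1)\<^sup>2 + \<kappa>1 - 1) * \<rho>sq)) * e
      + (h + 2 * h\<^sup>2) * (2 * Lf\<^sup>2) * e \<le> - \<epsilon>3 * e"
    using mult_right_mono[OF coeff_consensus nonneg(1)] by (simp only: distrib_right)
  have 4: "(- \<kappa>2 + h / 2 * k3 + 2 * \<kappa>2\<^sup>2) * w \<le> - \<epsilon>4 * w"
    using nonneg by (intro mult_right_mono coeff_dual)
  have 5: "h * \<epsilon> * V \<le> \<epsilon>3 * e + \<epsilon>4 * w"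
  proof -
    have "h * \<epsilon> * V \<le> h * \<epsilon> * (k5 * (e + w))" using V h eps_pos by (intro mult_left_mono) auto
    also have "\<dots> = (h * \<epsilon> * k5) * e + (h * \<epsilon> * k5) * w" by (simp add: algebra_simps)
    also have "\<dots> \<le> \<epsilon>3 * e + \<epsilon>4 * w"
      using nonneg by (intro add_mono mult_right_mono h_eps_k5)
    finally show ?thesis .
  qed
  have 6: "h * \<epsilon> * \<Phi> \<le> h * \<nu> * \<Phi>"
  proof (rule mult_right_mono)
    have "0 < h * \<nu>" using h nu_pos by simp
    then show "h * \<epsilon> \<le> h * \<nu>" using h_eps_le h_eps_k5(3) by linarith
  qed (use nonneg in simp)
  \<comment> \<open>The weight obtained is 2h + 4h^2; it is rounded up to 3h + 5h^2, the numerator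
    of \<open>breve_c5\<close> before a factor \<open>h\<close> cancels.\<close>
  have 7: "(h + 2 * h\<^sup>2) * (2 * S) \<le> (3 * h + 5 * h\<^sup>2) * S"
    using mult_right_mono[of "2 * (h + 2 * h\<^sup>2)" "3 * h + 5 * h\<^sup>2" S] h nonneg
    by (simp add: algebra_simps)
  have "(1 - h * \<epsilon>) * (V + \<Phi>) = V + \<Phi> - h * \<epsilon> * V - h * \<epsilon> * \<Phi>" by (simp add: algebra_simps)
  moreover
  \<comment> \<open>Naming the coefficients keeps each product with a squared norm a single monomial
    for \<open>linarith\<close>.\<close>
  define cE where "cE = - \<kappa>2 * (\<kappa>1 - 1) * \<rho>2 + h + \<kappa>2\<^sup>2 * (\<rho> + (2 * (\<kappa>1 - 1)\<^sup>2 + \<kappa>1 - 1) * \<rho>sq)"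
  define cw where "cw = - \<kappa>2 + h / 2 * k3 + 2 * \<kappa>2\<^sup>2"
  define cD where "cD = h + 2 * h\<^sup>2"
  define cd where "cd = k3 / (2 * h) + k3"
  define cS where "cS = 3 * h + 5 * h\<^sup>2"
  note folds = cE_def[symmetric] cw_def[symmetric] cD_def[symmetric] cd_def[symmetric] cS_def[symmetric]
  ultimately show ?thesis
    using V'[unfolded folds] \<Phi>' 1[unfolded folds] 2[unfolded folds] 3[unfolded folds]
      4[unfolded folds] 5 6 7[unfolded folds]
    unfolding folds minus_mult_left[symmetric] by linarith
qed

section \<open>The Lyapunov function along one step\<close>

abbreviation "F \<equiv> avg_cost f"

definition cons :: "('n \<Rightarrow> real^'p) \<Rightarrow> real^('n \<times> 'p)" where
  "cons X = stack (\<lambda>i. X i - mean X)"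

text \<open>Shifting \<^term>\<open>V\<close> by the scaled gradients at the mean makes the optimal dual variable \<open>0\<close>.\<close>

definition dual :: "('n \<Rightarrow> real^'p) \<Rightarrow> ('n \<Rightarrow> real^'p) \<Rightarrow> real^('n \<times> 'p)" where
  "dual X V = cons (\<lambda>i. V i + (1 / b) *\<^sub>R grad (f i) (mean X))"

definition gap :: "('n \<Rightarrow> real^'p) \<Rightarrow> real" where
  "gap X = real CARD('n) * (F (mean X) - fstar)"

text \<open>The formula of the initial value serves as the Lyapunov function at every
  iterate.\<close>

abbreviation "lyap X V \<equiv> lyapunov0 L f fstar \<kappa>1 b X V"

lemma centered_cons: "centered (cons X)"
  by (simp add: cons_def centered_stack_iff sum_minus_mean)

lemma cons_linear:
  "cons (\<lambda>i. X i + Y i) = cons X + cons Y" "cons (\<lambda>i. X i - Y i) = cons X - cons Y"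
  "cons (\<lambda>i. c *\<^sub>R X i) = c *\<^sub>R cons X"
  by (simp_all add: cons_def mean_linear stack_linear algebra_simps)

text \<open>The shifted dual variable enters \<open>lyapunov0\<close> only through
  \<open>matrix_K\<close> and \<open>matrix_Q\<close>, both blind to constant stacks, so it may be
  centred.\<close>

lemma lyapunov0_eq: "lyap X V = pd_energy Q \<kappa>1 (cons X) (dual X V) + gap X"
proof -
  define Y where "Y = (\<lambda>i. V i + (1 / b) *\<^sub>R grad (f i) (mean X))"
  have st: "stack V + (1 / b) *\<^sub>R stack (\<lambda>i. grad (f i) (mean X)) = stack Y"
    by (simp add: Y_def stack_linear)
  have du: "dual X V = cons Y" by (simp add: dual_def Y_def)
  show ?thesis
    unfolding lyapunov0_def Let_def st pd_energy_def du gap_def sqnorm_wrt_def matrix_K_stack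
      matrix_vector_mult_add_rdistrib inner_add_right
    by (simp add: scaleR_matrix_vector_assoc[symmetric] matrix_K_stack cons_def
        inner_stack_minus_mean[of X] inner_stack_minus_mean[of Y Y]
        matrix_Q_form_minus_mean[of Y] algebra_simps add_divide_distrib)
qed

lemma gap_nonneg: "0 \<le> gap X"
  using minval by (simp add: gap_def is_min_value_def)

lemma energy_le: "pd_energy Q \<kappa>1 (cons X) (dual X V) \<le> k5 * (cons X \<bullet> cons X + dual X V \<bullet> dual X V)"
proof -
  have "pd_energy Q \<kappa>1 (cons X) (dual X V) \<le> cons X \<bullet> cons X + k5 * (dual X V \<bullet> dual X V)"
    unfolding kappa5_def dual_def by (intro pd_energy_le matrix_Q_form_le centered_cons)
  also have "\<dots> \<le> k5 * (cons X \<bullet> cons X) + k5 * (dual X V \<bullet> dual X V)"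
    using mult_right_mono[OF k5_ge1, of "cons X \<bullet> cons X"] by simp
  finally show ?thesis by (simp add: distrib_left)
qed

lemma lyapunov_ge: "k6 * (cons X \<bullet> cons X) + gap X \<le> lyap X V"
proof -
  have "k6 * (cons X \<bullet> cons X) \<le> (\<kappa>1 - 1) / (2 * \<kappa>1) * (cons X \<bullet> cons X)"
    by (intro mult_right_mono) (auto simp: kappa6_def)
  also have "\<dots> \<le> (\<kappa>1 - 1) / (2 * \<kappa>1) * (cons X \<bullet> cons X) + 1 / (2 * \<rho>) * (dual X V \<bullet> dual X V)"
    using rho_pos by simp
  also have "\<dots> \<le> pd_energy Q \<kappa>1 (cons X) (dual X V)"
    unfolding dual_def using \<kappa>1_gt1 by (intro pd_energy_ge matrix_Q_form_ge centered_cons) auto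
  finally show ?thesis unfolding lyapunov0_eq by simp
qed

lemma lyapunov_nonneg: "0 \<le> lyap X V"
  using lyapunov_ge[of X V] gap_nonneg[of X] k6_pos
  by (meson add_nonneg_nonneg inner_ge_zero less_imp_le mult_nonneg_nonneg order_trans)

text \<open>\<open>k6 \<le> 1\<close> lets the single factor \<open>k6\<close> serve both the
  consensus error and the gap.\<close>

lemma objective_le_lyapunov:
  "(1 / real CARD('n)) * (\<Sum>i\<in>UNIV. (norm (X i - mean X))\<^sup>2) + F (mean X) - fstar
    \<le> lyap X V / (real CARD('n) * k6)"
proof -
  have "k6 * gap X \<le> 1 * gap X" using k6_le gap_nonneg by (intro mult_right_mono)
  then have "k6 * (cons X \<bullet> cons X + gap X) \<le> lyap X V"
    using lyapunov_ge[of X V] by (simp add: distrib_left)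
  moreover have "cons X \<bullet> cons X = (\<Sum>i\<in>UNIV. (norm (X i - mean X))\<^sup>2)"
    by (simp add: cons_def inner_stack power2_norm_eq_inner)
  moreover have "((1 / real CARD('n)) * A + F (mean X) - fstar) * (real CARD('n) * k6) = k6 * (A + gap X)" for A
    by (simp add: gap_def field_simps)
  moreover have "0 < real CARD('n) * k6" using k6_pos by simp
  ultimately show ?thesis by (simp only: pos_le_divide_eq)
qed

text \<open>By symmetry the columns of \<open>L\<close> sum to 0, so communication leaves the mean
  untouched.\<close>

lemma L_mean: "mean (\<lambda>i. \<Sum>j\<in>UNIV. L $ i $ j *\<^sub>R Y j) = (0 :: real^'p)"
proof -
  have "(\<Sum>i\<in>UNIV. L $ i $ j) = 0" for j
    using weighted_laplacian_row_sum[OF L, of j] L by (simp add: weighted_laplacian_def)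
  then have "(\<Sum>i\<in>UNIV. \<Sum>j\<in>UNIV. L $ i $ j *\<^sub>R Y j) = 0"
    by (subst sum.swap) (simp flip: scaleR_left.sum)
  then show ?thesis by (simp add: mean_def)
qed

lemma cons_L: "cons (\<lambda>i. \<Sum>j\<in>UNIV. L $ i $ j *\<^sub>R X j) = Lk (cons X)"
  by (simp add: cons_def L_mean kronecker_stack scaleR_right_diff_distrib sum_subtractf
      weighted_laplacian_row_sum[OF L] flip: scaleR_left.sum)

lemma grad_F: "grad F y = mean (\<lambda>i. grad (f i) y)" and GDERIV_F: "GDERIV F y :> grad F y"
proof -
  have "GDERIV F y :> mean (\<lambda>i. grad (f i) y)" by (rule grad_avg_cost[where f = f, OF diff])
  then show "grad F y = mean (\<lambda>i. grad (f i) y)" "GDERIV F y :> grad F y"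
    using grad_eqI by metis+
qed

text \<open>The Polyak-Lojasiewicz condition uses up the squared gradient of \<open>F\<close>; the
  term in -|gm|^2 keeps its full weight h/2 for \<open>coeff_mean_gradient\<close>.\<close>

lemma gap_step:
  assumes X': "mean X' = mean X - h *\<^sub>R gm"
  shows "gap X' \<le> gap X - h * \<nu> * gap X - h / 2 * (real CARD('n) * (gm \<bullet> gm))
    + h / 2 * (real CARD('n) * ((gm - grad F (mean X)) \<bullet> (gm - grad F (mean X))))
    + h\<^sup>2 * Lf / 2 * (real CARD('n) * (gm \<bullet> gm))"
proof -
  define g where "g = grad F (mean X)"
  have lip: "norm (grad F y - grad F z) \<le> Lf * norm (y - z)" for y z
  proof -
    have "norm (grad F y - grad F z) = norm (\<Sum>i\<in>UNIV. grad (f i) y - grad (f i) z) / real CARD('n)"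
      unfolding grad_F mean_linear[symmetric] by (simp add: mean_def)
    also have "\<dots> \<le> (\<Sum>i\<in>(UNIV :: 'n set). Lf * norm (y - z)) / real CARD('n)"
      by (intro divide_right_mono sum_norm_le smooth) simp
    finally show ?thesis by simp
  qed
  have "F (mean X') \<le> F (mean X) + g \<bullet> (mean X' - mean X) + Lf / 2 * ((mean X' - mean X) \<bullet> (mean X' - mean X))"
    unfolding g_def by (rule lipschitz_gradient_descent[OF GDERIV_F lip])
  also have "mean X' - mean X = - (h *\<^sub>R gm)" by (simp add: X')
  finally have 1: "F (mean X') \<le> F (mean X) - h * (g \<bullet> gm) + h\<^sup>2 * Lf / 2 * (gm \<bullet> gm)"
    by (simp add: power2_eq_square mult_ac)
  have "h * (g \<bullet> gm) = h / 2 * (g \<bullet> g) + h / 2 * (gm \<bullet> gm) - h / 2 * ((gm - g) \<bullet> (gm - g))"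
    by (simp add: inner_diff_left inner_diff_right inner_commute algebra_simps add_divide_distrib)
  moreover have "h * (\<nu> * (F (mean X) - fstar)) \<le> h * (1 / 2 * (norm g)\<^sup>2)"
    unfolding g_def using h_pos PL by (intro mult_left_mono) auto
  ultimately have "F (mean X') - fstar \<le> (F (mean X) - fstar) - h * (\<nu> * (F (mean X) - fstar))
      - h / 2 * (gm \<bullet> gm) + h / 2 * ((gm - g) \<bullet> (gm - g)) + h\<^sup>2 * Lf / 2 * (gm \<bullet> gm)"
    using 1 by (simp add: dot_square_norm)
  from mult_left_mono[OF this, of "real CARD('n)"] show ?thesis
    unfolding gap_def g_def by (simp add: algebra_simps)
qed

text \<open>\<open>G\<close> is an arbitrary family in place of the stochastic gradients, so the
  step applies to each outcome separately. The invariant \<open>mean V = 0\<close> removes the duals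
  from the update of the mean.\<close>

lemma lyapunov_step:
  fixes X V G X' V' :: "'n \<Rightarrow> real^'p"
  assumes V0: "mean V = 0"
    and X': "\<And>i. X' i = X i - h *\<^sub>R ((\<kappa>1 * b) *\<^sub>R (\<Sum>j\<in>UNIV. L $ i $ j *\<^sub>R X j) + b *\<^sub>R V i + G i)"
    and V': "\<And>i. V' i = V i + (h * b) *\<^sub>R (\<Sum>j\<in>UNIV. L $ i $ j *\<^sub>R X j)"
  shows "mean V' = 0"
    and "lyap X' V' \<le> (1 - h * \<epsilon>) * lyap X V
      + (3 * h + 5 * h\<^sup>2) * (\<Sum>i\<in>UNIV. (norm (G i - grad (f i) (X i)))\<^sup>2)"
proof -
  define l where "l i = (\<Sum>j\<in>UNIV. L $ i $ j *\<^sub>R X j)" for i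
  have l: "mean l = 0" unfolding l_def by (rule L_mean)
  have X'l: "X' = (\<lambda>i. X i - h *\<^sub>R ((\<kappa>1 * b) *\<^sub>R l i + b *\<^sub>R V i + G i))"
    and V'l: "V' = (\<lambda>i. V i + (h * b) *\<^sub>R l i)"
    using X' V' by (auto simp: l_def)
  show "mean V' = 0" unfolding V'l by (simp add: mean_linear l V0)
  have mX': "mean X' = mean X - h *\<^sub>R mean G"
    unfolding X'l by (simp add: mean_linear l V0)
  define g0 where "g0 i = grad (f i) (mean X)" for i
  define d where "d i = G i - g0 i" for i
  define D where "D i = (1 / b) *\<^sub>R (grad (f i) (mean X') - g0 i)" for i
  define S where "S = (\<Sum>i\<in>UNIV. (norm (G i - grad (f i) (X i)))\<^sup>2)"
  have b: "0 < b" using b_ge1 by simp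
  have consX': "cons X' = cons X - \<kappa>2 *\<^sub>R (\<kappa>1 *\<^sub>R Lk (cons X) + dual X V) - h *\<^sub>R cons d"
  proof -
    \<comment> \<open>\<open>b *\<^sub>R V i + G i\<close> is regrouped as \<open>b\<close> times
      the shifted dual variable plus the error \<open>d i\<close>; with
      \<open>h * b = \<kappa>2\<close> this is the form that \<open>pd_energy_step_le\<close>
      expects.\<close>
    have "X' i = X i - \<kappa>2 *\<^sub>R (\<kappa>1 *\<^sub>R l i + (V i + (1 / b) *\<^sub>R g0 i)) - h *\<^sub>R d i" for i
      unfolding X'l d_def hb[symmetric] using b by (simp add: algebra_simps)
    then have "X' = (\<lambda>i. X i - \<kappa>2 *\<^sub>R (\<kappa>1 *\<^sub>R l i + (V i + (1 / b) *\<^sub>R g0 i)) - h *\<^sub>R d i)" by blast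
    then show ?thesis
      by (simp add: cons_linear dual_def g0_def cons_L[symmetric] l_def)
  qed
  have dual': "dual X' V' = dual X V + \<kappa>2 *\<^sub>R Lk (cons X) + cons D"
  proof -
    \<comment> \<open>The shift of the dual variable moves with the mean, and \<open>D\<close> is
      this movement.\<close>
    have "V' i + (1 / b) *\<^sub>R grad (f i) (mean X') = (V i + (1 / b) *\<^sub>R g0 i) + \<kappa>2 *\<^sub>R l i + D i" for i
      unfolding V'l D_def hb by (simp add: algebra_simps)
    then show ?thesis
      unfolding dual_def by (simp add: cons_linear g0_def cons_L[symmetric] l_def)
  qed
  have energy: "pd_energy Q \<kappa>1 (cons X') (dual X' V') \<le> pd_energy Q \<kappa>1 (cons X) (dual X V)
      + (- \<kappa>2 * (\<kappa>1 - 1) * \<rho>2 + h + \<kappa>2\<^sup>2 * (\<rho> + (2 * (\<kappa>1 - 1)\<^sup>2 + \<kappa>1 - 1) * \<rho>sq)) * (cons X \<bullet> cons X)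
      + (- \<kappa>2 + h / 2 * k3 + 2 * \<kappa>2\<^sup>2) * (dual X V \<bullet> dual X V)
      + (h + 2 * h\<^sup>2) * (cons d \<bullet> cons d) + (k3 / (2 * h) + k3) * (cons D \<bullet> cons D)"
    unfolding consX' dual'
    by (rule pd_energy_step_le[OF matrix_vector_mul_linear matrix_Q_sym matrix_Q_L[OF centered_cons]
          matrix_Q_psd rho2_pos kron_L_form_ge[OF centered_cons] kron_L_form_le[OF centered_cons]
          kron_L_norm_le[OF centered_cons] matrix_Q_form_le[OF centered_cons]
          matrix_Q_norm_le[OF centered_cons] \<kappa>1_gt1 \<kappa>2_pos h_pos kappa3_def])
  have md: "mean G - grad F (mean X) = mean d"
    unfolding grad_F d_def g0_def by (simp add: mean_linear)
  have dd: "cons d \<bullet> cons d + real CARD('n) * (mean d \<bullet> mean d) \<le> 2 * S + 2 * Lf\<^sup>2 * (cons X \<bullet> cons X)"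
  proof -
    have "cons d \<bullet> cons d + real CARD('n) * (mean d \<bullet> mean d) = (\<Sum>i\<in>UNIV. d i \<bullet> d i)"
      using sum_inner_minus_mean[of d] by (simp add: cons_def inner_stack)
    also have "\<dots> \<le> (\<Sum>i\<in>UNIV. 2 * (norm (G i - grad (f i) (X i)))\<^sup>2 + 2 * (Lf\<^sup>2 * ((X i - mean X) \<bullet> (X i - mean X))))"
    proof (rule sum_mono)
      fix i
      have "d i \<bullet> d i \<le> 2 * ((G i - grad (f i) (X i)) \<bullet> (G i - grad (f i) (X i)))
          + 2 * ((grad (f i) (X i) - g0 i) \<bullet> (grad (f i) (X i) - g0 i))"
        using inner_add_self_le[of "G i - grad (f i) (X i)" "grad (f i) (X i) - g0 i"] by (simp add: d_def)
      moreover have "(norm (grad (f i) (X i) - g0 i))\<^sup>2 \<le> (Lf * norm (X i - mean X))\<^sup>2"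
        unfolding g0_def by (intro power_mono smooth) simp
      ultimately show "d i \<bullet> d i \<le> 2 * (norm (G i - grad (f i) (X i)))\<^sup>2 + 2 * (Lf\<^sup>2 * ((X i - mean X) \<bullet> (X i - mean X)))"
        by (simp add: dot_square_norm power_mult_distrib)
    qed
    also have "\<dots> = 2 * S + 2 * Lf\<^sup>2 * (cons X \<bullet> cons X)"
      by (simp add: sum.distrib S_def cons_def inner_stack sum_distrib_left mult.assoc)
    finally show ?thesis .
  qed
  have DD: "cons D \<bullet> cons D \<le> (Lf / b)\<^sup>2 * h\<^sup>2 * (real CARD('n) * (mean G \<bullet> mean G))"
  proof -
    have "cons D \<bullet> cons D \<le> (\<Sum>i\<in>UNIV. D i \<bullet> D i)"
      using sum_inner_minus_mean[of D] by (simp add: cons_def inner_stack)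
    also have "\<dots> \<le> (\<Sum>i\<in>(UNIV::'n set). (Lf / b)\<^sup>2 * h\<^sup>2 * (mean G \<bullet> mean G))"
    proof (rule sum_mono)
      fix i
      have "norm (D i) \<le> Lf / b * h * norm (mean G)"
      proof -
        \<comment> \<open>The mean moves by exactly \<open>h\<close> times the averaged gradient, so
          only that gradient governs the drift.\<close>
        have "norm (grad (f i) (mean X') - g0 i) \<le> Lf * (h * norm (mean G))"
          using smooth[of i "mean X'" "mean X"] h_pos by (simp add: g0_def mX')
        from divide_right_mono[OF this, of b] show ?thesis using b by (simp add: D_def)
      qed
      then have "(norm (D i))\<^sup>2 \<le> (Lf / b * h * norm (mean G))\<^sup>2" by (intro power_mono) auto
      then show "D i \<bullet> D i \<le> (Lf / b)\<^sup>2 * h\<^sup>2 * (mean G \<bullet> mean G)"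
        by (simp add: dot_square_norm power_mult_distrib power_divide)
    qed
    finally show ?thesis by (simp add: mult_ac)
  qed
  have "pd_energy Q \<kappa>1 (cons X') (dual X' V') + gap X'
      \<le> (1 - h * \<epsilon>) * (pd_energy Q \<kappa>1 (cons X) (dual X V) + gap X) + (3 * h + 5 * h\<^sup>2) * S"
    by (rule descent_combine[OF energy gap_step[OF mX', unfolded md] dd DD energy_le])
      (auto simp: gap_nonneg S_def sum_nonneg)
  then show "lyap X' V' \<le> (1 - h * \<epsilon>) * lyap X V
      + (3 * h + 5 * h\<^sup>2) * (\<Sum>i\<in>UNIV. (norm (G i - grad (f i) (X i)))\<^sup>2)"
    unfolding lyapunov0_eq S_def .
qed

end

section \<open>Expectation\<close>

lemma (in prob_space) nn_integral_indep_le: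
  assumes ind: "indep_var S X T Y" and u: "u \<in> borel_measurable (S \<Otimes>\<^sub>M T)"
    and le: "\<And>y. y \<in> space S \<Longrightarrow> (\<integral>\<^sup>+\<omega>. u (y, Y \<omega>) \<partial>M) \<le> c"
  shows "(\<integral>\<^sup>+\<omega>. u (X \<omega>, Y \<omega>) \<partial>M) \<le> c"
proof -
  have X: "X \<in> M \<rightarrow>\<^sub>M S" and Y: "Y \<in> M \<rightarrow>\<^sub>M T"
    using ind by (auto dest: indep_var_rv1 indep_var_rv2)
  interpret X: prob_space "distr M S X" by (rule prob_space_distr[OF X])
  interpret Y: prob_space "distr M T Y" by (rule prob_space_distr[OF Y])
  have u': "u \<in> borel_measurable (distr M S X \<Otimes>\<^sub>M distr M T Y)"
    using u by simp
  have "(\<integral>\<^sup>+\<omega>. u (X \<omega>, Y \<omega>) \<partial>M) = (\<integral>\<^sup>+p. u p \<partial>distr M (S \<Otimes>\<^sub>M T) (\<lambda>\<omega>. (X \<omega>, Y \<omega>)))"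
    using X Y u by (subst nn_integral_distr) auto
  also have "\<dots> = (\<integral>\<^sup>+p. u p \<partial>(distr M S X \<Otimes>\<^sub>M distr M T Y))"
    using ind by (simp add: indep_var_distribution_eq)
  also have "\<dots> = (\<integral>\<^sup>+y. \<integral>\<^sup>+z. u (y, z) \<partial>distr M T Y \<partial>distr M S X)"
    by (rule Y.nn_integral_fst[OF u', symmetric])
  also have "\<dots> \<le> (\<integral>\<^sup>+y. c \<partial>distr M S X)"
  proof (rule nn_integral_mono)
    fix y assume "y \<in> space (distr M S X)"
    then have y: "y \<in> space S" by simp
    have "(\<lambda>z. u (y, z)) \<in> borel_measurable T"
      using u y by measurable
    then show "(\<integral>\<^sup>+z. u (y, z) \<partial>distr M T Y) \<le> c"
      using le[OF y] Y by (simp add: nn_integral_distr)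
  qed
  also have "\<dots> = c" using X.emeasure_space_1 by simp
  finally show ?thesis .
qed

locale pd_sgd_run = pd_sgd E L lam r f fstar Lf \<nu> \<kappa>1 \<kappa>2 b h + prob_space M
  for E :: "('n::finite \<times> 'n) set" and L :: "real^'n^'n" and lam r
    and f :: "'n \<Rightarrow> real^'p::finite \<Rightarrow> real" and fstar Lf \<nu> \<kappa>1 \<kappa>2 b h :: real and M :: "'w measure" +
  fixes N :: "'n \<Rightarrow> 'z measure" and \<xi> :: "'n \<Rightarrow> nat \<Rightarrow> 'w \<Rightarrow> 'z"
    and g :: "'n \<Rightarrow> real^'p \<Rightarrow> 'z \<Rightarrow> real^'p" and x0 :: "'n \<Rightarrow> real^'p"
    and x v :: "'n \<Rightarrow> nat \<Rightarrow> 'w \<Rightarrow> real^'p" and \<sigma> :: real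
  assumes meas: "\<And>i. (\<lambda>(y, z). g i y z) \<in> borel \<Otimes>\<^sub>M N i \<rightarrow>\<^sub>M borel"
    and indep: "indep_vars (\<lambda>(i, k). N i) (\<lambda>(i, k). \<xi> i k) UNIV"
    and variance_integrable:
      "\<And>i k y. integrable M (\<lambda>\<omega>. (norm (g i y (\<xi> i k \<omega>) - grad (f i) y))\<^sup>2)"
    and variance_bound:
      "\<And>i k y. (\<integral>\<omega>. (norm (g i y (\<xi> i k \<omega>) - grad (f i) y))\<^sup>2 \<partial>M) \<le> \<sigma>\<^sup>2"
    and x_0: "\<And>i \<omega>. \<omega> \<in> space M \<Longrightarrow> x i 0 \<omega> = x0 i"
    and v_0: "\<And>i \<omega>. \<omega> \<in> space M \<Longrightarrow> v i 0 \<omega> = 0"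
    and x_Suc: "\<And>i k \<omega>. \<omega> \<in> space M \<Longrightarrow> x i (Suc k) \<omega> = x i k \<omega> - h *\<^sub>R
        ((\<kappa>1 * b) *\<^sub>R (\<Sum>j\<in>UNIV. L $ i $ j *\<^sub>R x j k \<omega>) + b *\<^sub>R v i k \<omega> + g i (x i k \<omega>) (\<xi> i k \<omega>))"
    and v_Suc: "\<And>i k \<omega>. \<omega> \<in> space M \<Longrightarrow>
        v i (Suc k) \<omega> = v i k \<omega> + (h * b) *\<^sub>R (\<Sum>j\<in>UNIV. L $ i $ j *\<^sub>R x j k \<omega>)"
begin

abbreviation "Z p \<equiv> (case p of (i, k) \<Rightarrow> \<xi> i k)"
abbreviation "MZ p \<equiv> (case p of (i, k :: nat) \<Rightarrow> N i)"
abbreviation "past k \<equiv> (UNIV :: 'n set) \<times> {..<k :: nat}"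

section \<open>Iterates as functions of the past, and the expected noise\<close>

lemma measurable_Z: "(\<lambda>\<omega>. \<xi> i k \<omega>) \<in> M \<rightarrow>\<^sub>M N i"
  using indep unfolding indep_vars_def2 by force

lemma measurable_g [measurable (raw)]:
  assumes "X \<in> A \<rightarrow>\<^sub>M borel" "Y \<in> A \<rightarrow>\<^sub>M N i"
  shows "(\<lambda>\<omega>. g i (X \<omega>) (Y \<omega>)) \<in> A \<rightarrow>\<^sub>M borel"
  using measurable_compose[OF measurable_Pair[OF assms] meas[of i]] by simp

lemma measurable_grad [measurable]: "grad (f i) \<in> borel_measurable borel"
proof -
  have "continuous_on UNIV (grad (f i))"
    using Lf_pos smooth[of i]
    by (intro lipschitz_on_continuous_on[of Lf] lipschitz_onI) (auto simp: dist_norm)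
  then show ?thesis by (rule borel_measurable_continuous_onI)
qed

text \<open>Explicit measurable functions of the earlier samples stand in for a filtration. One
  induction treats all agents, since the update of \<open>i\<close> mixes the
  \<open>x j\<close>.\<close>

lemma iterates_depend_on_past:
  "\<exists>\<Phi> \<Psi>. (\<forall>i. \<Phi> i \<in> PiM (past k) MZ \<rightarrow>\<^sub>M borel \<and> \<Psi> i \<in> PiM (past k) MZ \<rightarrow>\<^sub>M borel) \<and>
    (\<forall>\<omega>\<in>space M. \<forall>i. x i k \<omega> = \<Phi> i (restrict (\<lambda>p. Z p \<omega>) (past k)) \<and>
                     v i k \<omega> = \<Psi> i (restrict (\<lambda>p. Z p \<omega>) (past k)))"
proof (induction k)
  case 0
  show ?case
    by (rule exI[of _ "\<lambda>i _. x0 i"], rule exI[of _ "\<lambda>i _. 0"]) (simp add: x_0 v_0)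
next
  case (Suc k)
  then obtain \<Phi> \<Psi> where meas\<Phi>: "\<And>i. \<Phi> i \<in> PiM (past k) MZ \<rightarrow>\<^sub>M borel"
    and meas\<Psi>: "\<And>i. \<Psi> i \<in> PiM (past k) MZ \<rightarrow>\<^sub>M borel"
    and eq: "\<And>\<omega> i. \<omega> \<in> space M \<Longrightarrow> x i k \<omega> = \<Phi> i (restrict (\<lambda>p. Z p \<omega>) (past k))"
      "\<And>\<omega> i. \<omega> \<in> space M \<Longrightarrow> v i k \<omega> = \<Psi> i (restrict (\<lambda>p. Z p \<omega>) (past k))"
    by blast
  let ?P = "PiM (past (Suc k)) MZ"
  have sub: "past k \<subseteq> past (Suc k)" by auto
  have res: "(\<lambda>z. restrict z (past k)) \<in> ?P \<rightarrow>\<^sub>M PiM (past k) MZ"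
    by (rule measurable_restrict_subset[OF sub])
  have [measurable]: "(\<lambda>z. \<Phi> i (restrict z (past k))) \<in> ?P \<rightarrow>\<^sub>M borel"
    "(\<lambda>z. \<Psi> i (restrict z (past k))) \<in> ?P \<rightarrow>\<^sub>M borel" for i
    using measurable_compose[OF res meas\<Phi>] measurable_compose[OF res meas\<Psi>] by auto
  have [measurable]: "(\<lambda>z. z (i, k)) \<in> ?P \<rightarrow>\<^sub>M N i" for i
    using measurable_component_singleton[of "(i, k)" "past (Suc k)" MZ] by simp
  have rr: "restrict (restrict (\<lambda>p. Z p \<omega>) (past (Suc k))) (past k) = restrict (\<lambda>p. Z p \<omega>) (past k)" for \<omega>
    using sub by (simp add: Int_absorb1)
  define \<Phi>' where "\<Phi>' i z = \<Phi> i (restrict z (past k)) - h *\<^sub>R ((\<kappa>1 * b) *\<^sub>R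
      (\<Sum>j\<in>UNIV. L $ i $ j *\<^sub>R \<Phi> j (restrict z (past k)))
      + b *\<^sub>R \<Psi> i (restrict z (past k)) + g i (\<Phi> i (restrict z (past k))) (z (i, k)))" for i z
  define \<Psi>' where "\<Psi>' i z = \<Psi> i (restrict z (past k)) + (h * b) *\<^sub>R
      (\<Sum>j\<in>UNIV. L $ i $ j *\<^sub>R \<Phi> j (restrict z (past k)))" for i z
  have "\<Phi>' i \<in> ?P \<rightarrow>\<^sub>M borel" "\<Psi>' i \<in> ?P \<rightarrow>\<^sub>M borel" for i
    unfolding \<Phi>'_def \<Psi>'_def by measurable
  moreover have "x i (Suc k) \<omega> = \<Phi>' i (restrict (\<lambda>p. Z p \<omega>) (past (Suc k)))"
    "v i (Suc k) \<omega> = \<Psi>' i (restrict (\<lambda>p. Z p \<omega>) (past (Suc k)))" if "\<omega> \<in> space M" for i \<omega>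
    unfolding \<Phi>'_def \<Psi>'_def rr by (simp_all add: x_Suc v_Suc eq that)
  ultimately show ?case by blast
qed

lemma measurable_past: "(\<lambda>\<omega>. restrict (\<lambda>p. Z p \<omega>) (past k)) \<in> M \<rightarrow>\<^sub>M PiM (past k) MZ"
  by (rule measurable_restrict) (auto simp: measurable_Z)

lemma measurable_x [measurable]: "x i k \<in> borel_measurable M"
proof -
  obtain \<Phi> where "\<Phi> i \<in> PiM (past k) MZ \<rightarrow>\<^sub>M borel"
    and eq: "\<And>\<omega>. \<omega> \<in> space M \<Longrightarrow> x i k \<omega> = \<Phi> i (restrict (\<lambda>p. Z p \<omega>) (past k))"
    using iterates_depend_on_past[of k] by metis
  then have "(\<lambda>\<omega>. \<Phi> i (restrict (\<lambda>p. Z p \<omega>) (past k))) \<in> borel_measurable M"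
    using measurable_compose[OF measurable_past] by blast
  then show ?thesis by (subst measurable_cong[OF eq])
qed

definition noise :: "nat \<Rightarrow> 'w \<Rightarrow> real" where
  "noise k \<omega> = (\<Sum>i\<in>UNIV. (norm (g i (x i k \<omega>) (\<xi> i k \<omega>) - grad (f i) (x i k \<omega>)))\<^sup>2)"

lemma noise_summand:
  fixes i k
  defines "s \<equiv> \<lambda>\<omega>. (norm (g i (x i k \<omega>) (\<xi> i k \<omega>) - grad (f i) (x i k \<omega>)))\<^sup>2"
  shows "integrable M s" "(\<integral>\<omega>. s \<omega> \<partial>M) \<le> \<sigma>\<^sup>2"
proof -
  have [measurable]: "\<xi> i k \<in> M \<rightarrow>\<^sub>M N i" using measurable_Z[of i k] by simp
  have [measurable]: "s \<in> borel_measurable M" unfolding s_def by measurable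
  obtain \<Phi> where \<Phi>: "\<Phi> i \<in> PiM (past k) MZ \<rightarrow>\<^sub>M borel"
    and eq: "\<And>\<omega>. \<omega> \<in> space M \<Longrightarrow> x i k \<omega> = \<Phi> i (restrict (\<lambda>p. Z p \<omega>) (past k))"
    using iterates_depend_on_past[of k] by metis
  let ?P = "PiM (past k) MZ" and ?S = "PiM {(i, k)} MZ"
  \<comment> \<open>\<open>past k\<close> stops before time \<open>k\<close>, so the two index sets
    are disjoint and the restricted families independent.\<close>
  have ind: "indep_var ?P (\<lambda>\<omega>. restrict (\<lambda>p. Z p \<omega>) (past k)) ?S (\<lambda>\<omega>. restrict (\<lambda>p. Z p \<omega>) {(i, k)})"
    by (rule indep_var_restrict[OF indep]) auto
  define u where "u = (\<lambda>(y, z). ennreal ((norm (g i (\<Phi> i y) (z (i, k)) - grad (f i) (\<Phi> i y)))\<^sup>2))"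
  have [measurable]: "(\<lambda>z. z (i, k)) \<in> ?S \<rightarrow>\<^sub>M N i"
    using measurable_component_singleton[of "(i, k)" "{(i, k)}" MZ] by simp
  note \<Phi>[measurable]
  have "u \<in> borel_measurable (?P \<Otimes>\<^sub>M ?S)"
    unfolding u_def by measurable
  then have "(\<integral>\<^sup>+\<omega>. u (restrict (\<lambda>p. Z p \<omega>) (past k), restrict (\<lambda>p. Z p \<omega>) {(i, k)}) \<partial>M) \<le> ennreal (\<sigma>\<^sup>2)"
  proof (rule nn_integral_indep_le[OF ind])
    \<comment> \<open>With the past frozen at \<open>y\<close> the query point
      \<open>\<Phi> i y\<close> is deterministic, and the variance bound applies to it.\<close>
    fix y
    have "(\<integral>\<^sup>+\<omega>. u (y, restrict (\<lambda>p. Z p \<omega>) {(i, k)}) \<partial>M)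
        = ennreal (\<integral>\<omega>. (norm (g i (\<Phi> i y) (\<xi> i k \<omega>) - grad (f i) (\<Phi> i y)))\<^sup>2 \<partial>M)"
      unfolding u_def by (simp add: nn_integral_eq_integral[OF variance_integrable])
    then show "(\<integral>\<^sup>+\<omega>. u (y, restrict (\<lambda>p. Z p \<omega>) {(i, k)}) \<partial>M) \<le> ennreal (\<sigma>\<^sup>2)"
      using variance_bound by (simp add: ennreal_leI)
  qed
  also have "(\<integral>\<^sup>+\<omega>. u (restrict (\<lambda>p. Z p \<omega>) (past k), restrict (\<lambda>p. Z p \<omega>) {(i, k)}) \<partial>M)
      = (\<integral>\<^sup>+\<omega>. ennreal (s \<omega>) \<partial>M)"
    by (rule nn_integral_cong) (simp add: u_def s_def eq)
  finally have le: "(\<integral>\<^sup>+\<omega>. ennreal (s \<omega>) \<partial>M) \<le> ennreal (\<sigma>\<^sup>2)" .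
  \<comment> \<open>Integrability along the random iterates is a consequence of the finite
    nonnegative integral.\<close>
  then show "integrable M s"
    by (intro integrableI_nonneg) (auto simp: s_def intro: order_le_less_trans)
  then have "ennreal (\<integral>\<omega>. s \<omega> \<partial>M) \<le> ennreal (\<sigma>\<^sup>2)"
    using le by (subst (asm) nn_integral_eq_integral) (auto simp: s_def)
  then show "(\<integral>\<omega>. s \<omega> \<partial>M) \<le> \<sigma>\<^sup>2" by simp
qed

lemma noise_integrable: "integrable M (noise k)"
  and noise_integral: "(\<integral>\<omega>. noise k \<omega> \<partial>M) \<le> real CARD('n) * \<sigma>\<^sup>2"
proof -
  show "integrable M (noise k)"
    unfolding noise_def by (intro Bochner_Integration.integrable_sum noise_summand)
  have "(\<integral>\<omega>. noise k \<omega> \<partial>M) = (\<Sum>i\<in>UNIV. \<integral>\<omega>. (norm (g i (x i k \<omega>) (\<xi> i k \<omega>) - grad (f i) (x i k \<omega>)))\<^sup>2 \<partial>M)"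
    unfolding noise_def by (intro Bochner_Integration.integral_sum noise_summand)
  also have "\<dots> \<le> (\<Sum>i\<in>(UNIV :: 'n set). \<sigma>\<^sup>2)" by (intro sum_mono noise_summand)
  finally show "(\<integral>\<omega>. noise k \<omega> \<partial>M) \<le> real CARD('n) * \<sigma>\<^sup>2" by simp
qed

text \<open>A majorant of the Lyapunov values that is affine in the noise: it is plainly integrable,
  and its expectation obeys the recursion exactly.\<close>

primrec envelope :: "nat \<Rightarrow> 'w \<Rightarrow> real" where
  "envelope 0 \<omega> = lyap x0 (\<lambda>_. 0)"
| "envelope (Suc k) \<omega> = (1 - h * \<epsilon>) * envelope k \<omega> + (3 * h + 5 * h\<^sup>2) * noise k \<omega>"

lemma lyapunov_le_envelope:
  assumes "\<omega> \<in> space M"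
  shows "mean (\<lambda>i. v i k \<omega>) = 0 \<and> lyap (\<lambda>i. x i k \<omega>) (\<lambda>i. v i k \<omega>) \<le> envelope k \<omega>"
proof (induction k)
  case 0
  show ?case using assms by (simp add: x_0 v_0 mean_def)
next
  case (Suc k)
  note step = lyapunov_step[OF conjunct1[OF Suc] x_Suc[OF assms] v_Suc[OF assms]]
  have "(1 - h * \<epsilon>) * lyap (\<lambda>i. x i k \<omega>) (\<lambda>i. v i k \<omega>) \<le> (1 - h * \<epsilon>) * envelope k \<omega>"
    using Suc h_eps_lt1 by (intro mult_left_mono) auto
  then show ?case using step by (simp add: noise_def)
qed

lemma envelope_integrable: "integrable M (envelope k)"
  by (induction k) (simp_all add: noise_integrable)

text \<open>The error term is the fixed point C/q of the map taking a to (1 - q) a + C; it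
  reproduces itself in the induction, so no geometric sum appears.\<close>

lemma envelope_integral:
  "(\<integral>\<omega>. envelope k \<omega> \<partial>M)
    \<le> (1 - h * \<epsilon>) ^ k * lyap x0 (\<lambda>_. 0) + (3 * h + 5 * h\<^sup>2) * (real CARD('n) * \<sigma>\<^sup>2) / (h * \<epsilon>)"
proof (induction k)
  case 0
  show ?case using h_pos eps_pos by (simp add: prob_space)
next
  case (Suc k)
  let ?q = "h * \<epsilon>" and ?C = "(3 * h + 5 * h\<^sup>2) * (real CARD('n) * \<sigma>\<^sup>2)"
  have q: "0 < ?q" using h_pos eps_pos by simp
  have "(\<integral>\<omega>. envelope (Suc k) \<omega> \<partial>M)
      = (1 - ?q) * (\<integral>\<omega>. envelope k \<omega> \<partial>M) + (3 * h + 5 * h\<^sup>2) * (\<integral>\<omega>. noise k \<omega> \<partial>M)"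
    by (simp add: envelope_integrable noise_integrable)
  also have "\<dots> \<le> (1 - ?q) * ((1 - ?q) ^ k * lyap x0 (\<lambda>_. 0) + ?C / ?q) + ?C"
    using Suc h_eps_lt1 h_pos by (intro add_mono mult_left_mono noise_integral) auto
  also have "(1 - ?q) * (c / ?q) = c / ?q - c" for c
    using h_pos eps_pos by (simp only: left_diff_distrib) simp
  then have "(1 - ?q) * ((1 - ?q) ^ k * lyap x0 (\<lambda>_. 0) + ?C / ?q) + ?C
      = (1 - ?q) ^ Suc k * lyap x0 (\<lambda>_. 0) + ?C / ?q"
    by (simp add: distrib_left)
  finally show ?case .
qed

definition objective :: "nat \<Rightarrow> 'w \<Rightarrow> real" where
  "objective k \<omega> = (1 / real CARD('n)) * (\<Sum>i\<in>UNIV. (norm (x i k \<omega> - mean (\<lambda>j. x j k \<omega>)))\<^sup>2)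
     + F (mean (\<lambda>j. x j k \<omega>)) - fstar"

text \<open>The objective lies between 0 and a multiple of the envelope, which gives integrability
  and the bound together.\<close>

lemma objective_integrable: "integrable M (objective k)"
  and objective_integral:
    "(\<integral>\<omega>. objective k \<omega> \<partial>M) \<le> (1 - h * \<epsilon>) ^ k * c4 L \<kappa>1 (lyap x0 (\<lambda>_. 0)) + breve_c5 L \<nu> \<kappa>1 \<kappa>2 h * \<sigma>\<^sup>2"
proof -
  have "continuous_on UNIV F"
    using GDERIV_F by (auto simp: gderiv_def intro!: continuous_at_imp_continuous_on has_derivative_continuous)
  then have [measurable]: "F \<in> borel_measurable borel" by (rule borel_measurable_continuous_onI)
  have [measurable]: "(\<lambda>\<omega>. mean (\<lambda>j. x j k \<omega>)) \<in> borel_measurable M" unfolding mean_def by measurable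
  have [measurable]: "objective k \<in> borel_measurable M" unfolding objective_def by measurable
  have nonneg: "0 \<le> objective k \<omega>" for \<omega>
    using minval unfolding objective_def is_min_value_def
    by (simp add: add_nonneg_nonneg sum_nonneg add_diff_eq[symmetric])
  have le: "objective k \<omega> \<le> envelope k \<omega> / (real CARD('n) * k6)" if "\<omega> \<in> space M" for \<omega>
  proof -
    have "objective k \<omega> \<le> lyap (\<lambda>i. x i k \<omega>) (\<lambda>i. v i k \<omega>) / (real CARD('n) * k6)"
      unfolding objective_def by (rule objective_le_lyapunov)
    also have "\<dots> \<le> envelope k \<omega> / (real CARD('n) * k6)"
      using lyapunov_le_envelope[OF that, of k] k6_pos by (intro divide_right_mono) auto
    finally show ?thesis .
  qed
  have int: "integrable M (\<lambda>\<omega>. envelope k \<omega> / (real CARD('n) * k6))"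
    by (intro integrable_divide_zero envelope_integrable) 
  then show oi: "integrable M (objective k)"
  proof (rule Bochner_Integration.integrable_bound)
    have "norm (objective k \<omega>) \<le> norm (envelope k \<omega> / (real CARD('n) * k6))" if "\<omega> \<in> space M" for \<omega>
      using nonneg[of \<omega>] le[OF that] unfolding real_norm_def by linarith
    then show "AE \<omega> in M. norm (objective k \<omega>) \<le> norm (envelope k \<omega> / (real CARD('n) * k6))" by simp
  qed measurable
  have "(\<integral>\<omega>. objective k \<omega> \<partial>M) \<le> (\<integral>\<omega>. envelope k \<omega> / (real CARD('n) * k6) \<partial>M)"
    using oi int le by (rule integral_mono)
  also have "\<dots> = (\<integral>\<omega>. envelope k \<omega> \<partial>M) / (real CARD('n) * k6)" by simp
  also have "\<dots> \<le> ((1 - h * \<epsilon>) ^ k * lyap x0 (\<lambda>_. 0) + (3 * h + 5 * h\<^sup>2) * (real CARD('n) * \<sigma>\<^sup>2) / (h * \<epsilon>))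
      / (real CARD('n) * k6)"
    using k6_pos by (intro divide_right_mono envelope_integral) auto
  also have "\<dots> = (1 - h * \<epsilon>) ^ k * c4 L \<kappa>1 (lyap x0 (\<lambda>_. 0)) + breve_c5 L \<nu> \<kappa>1 \<kappa>2 h * \<sigma>\<^sup>2"
  proof -
    \<comment> \<open>The \<open>h\<close> of the rate cancels one \<open>h\<close> of the noise
      weight, and the number of agents drops out.\<close>
    have cancel: "(3 * h + 5 * h\<^sup>2) * (n * s) / (h * e) / (n * k) = (3 + 5 * h) / (e * k) * s"
      if "n \<noteq> 0" "e \<noteq> 0" "k \<noteq> 0" for n s e k :: real
      using that h_pos by (simp add: field_simps power2_eq_square)
    have "(3 * h + 5 * h\<^sup>2) * (real CARD('n) * \<sigma>\<^sup>2) / (h * \<epsilon>) / (real CARD('n) * k6) = (3 + 5 * h) / (\<epsilon> * k6) * \<sigma>\<^sup>2"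
      by (rule cancel) (use eps_pos k6_pos in auto)
    then show ?thesis
      by (subst add_divide_distrib) (simp only: c4_def breve_c5_def times_divide_eq_right)
  qed
  finally show "(\<integral>\<omega>. objective k \<omega> \<partial>M)
      \<le> (1 - h * \<epsilon>) ^ k * c4 L \<kappa>1 (lyap x0 (\<lambda>_. 0)) + breve_c5 L \<nu> \<kappa>1 \<kappa>2 h * \<sigma>\<^sup>2" .
qed

end

theorem theorem5:
  fixes E :: "('n::finite \<times> 'n) set" and L :: "real^'n^'n"
    and f :: "'n \<Rightarrow> real^'p::finite \<Rightarrow> real" and fstar Lf \<sigma> \<nu> :: real
    and M :: "'w measure" and N :: "'n \<Rightarrow> 'z measure"
    and \<xi> :: "'n \<Rightarrow> nat \<Rightarrow> 'w \<Rightarrow> 'z" and g :: "'n \<Rightarrow> real^'p \<Rightarrow> 'z \<Rightarrow> real^'p"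
    and \<alpha> \<beta> \<eta> :: "nat \<Rightarrow> real" and \<kappa>1 \<kappa>2 b h W0 :: real
    and x0 :: "'n \<Rightarrow> real^'p" and x v :: "'n \<Rightarrow> nat \<Rightarrow> 'w \<Rightarrow> real^'p"
  assumes "CARD('n) \<ge> 2"
    and graph: "connected_graph E" and laplacian: "weighted_laplacian E L"
    and diff: "\<And>i y. f i differentiable (at y)"
    and minval: "is_min_value (avg_cost f) fstar"
    and "Lf > 0"
    and smooth: "\<And>i y z. norm (grad (f i) y - grad (f i) z) \<le> Lf * norm (y - z)"
    and prob: "prob_space M"
    and meas: "\<And>i. (\<lambda>(y, z). g i y z) \<in> borel \<Otimes>\<^sub>M N i \<rightarrow>\<^sub>M borel"
    and indep: "prob_space.indep_vars M (\<lambda>(i, k). N i) (\<lambda>(i, k). \<xi> i k) UNIV"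
    and variance_integrable:
      "\<And>i k y. integrable M (\<lambda>\<omega>. (norm (g i y (\<xi> i k \<omega>) - grad (f i) y))\<^sup>2)"
    and variance_bound:
      "\<And>i k y. (\<integral>\<omega>. (norm (g i y (\<xi> i k \<omega>) - grad (f i) y))\<^sup>2 \<partial>M) \<le> \<sigma>\<^sup>2"
    and "\<nu> > 0"
    and PL: "\<And>y. 1/2 * (norm (grad (avg_cost f) y))\<^sup>2 \<ge> \<nu> * (avg_cost f y - fstar)"
    and algorithm: "primal_dual_sgd (space M) L \<alpha> \<beta> \<eta> g \<xi> x0 x v"
    and params: "\<And>k. \<alpha> k = \<kappa>1 * b" "\<And>k. \<beta> k = b" "\<And>k. \<eta> k = h" "h = \<kappa>2 / b"
    and "\<kappa>1 > c1 L" and "0 < \<kappa>2" and "\<kappa>2 < c2 L \<kappa>1"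
    and "b \<ge> breve_c0 L Lf \<kappa>1 \<kappa>2"
    and W0: "W0 = lyapunov0 L f fstar \<kappa>1 b x0 (\<lambda>_. 0)"
  shows "0 < eps L \<nu> \<kappa>1 \<kappa>2 h \<and> eps L \<nu> \<kappa>1 \<kappa>2 h < 1 / h \<and>
    0 \<le> c4 L \<kappa>1 W0 \<and> (W0 \<noteq> 0 \<longrightarrow> 0 < c4 L \<kappa>1 W0) \<and> 0 < breve_c5 L \<nu> \<kappa>1 \<kappa>2 h \<and>
    (\<forall>k\<ge>1.
       integrable M (\<lambda>\<omega>. (1 / real CARD('n)) *
            (\<Sum>i\<in>UNIV. (norm (x i k \<omega> - mean (\<lambda>j. x j k \<omega>)))\<^sup>2)
          + avg_cost f (mean (\<lambda>j. x j k \<omega>)) - fstar) \<and>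
       (\<integral>\<omega>. (1 / real CARD('n)) *
            (\<Sum>i\<in>UNIV. (norm (x i k \<omega> - mean (\<lambda>j. x j k \<omega>)))\<^sup>2)
          + avg_cost f (mean (\<lambda>j. x j k \<omega>)) - fstar \<partial>M)
         \<le> (1 - h * eps L \<nu> \<kappa>1 \<kappa>2 h) ^ k * c4 L \<kappa>1 W0 + breve_c5 L \<nu> \<kappa>1 \<kappa>2 h * \<sigma>\<^sup>2)"
proof -
  obtain lam r where "connected_laplacian E L lam r"
    using connected_laplacianI[OF laplacian graph assms(1)] by blast
  then interpret pd_sgd_run E L lam r f fstar Lf \<nu> \<kappa>1 \<kappa>2 b h M N \<xi> g x0 x v \<sigma>
    using assms unfolding primal_dual_sgd_def
    by (auto simp: pd_sgd_run_def pd_sgd_def pd_sgd_axioms_def pd_sgd_run_axioms_def)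
  have "\<epsilon> < 1 / h" using h_eps_lt1 h_pos by (simp add: field_simps)
  \<comment> \<open>\<open>W0\<close> is 0 if all agents start at a common minimiser of all
    \<open>f i\<close>, so strict positivity has to be conditional.\<close>
  moreover have "0 \<le> c4 L \<kappa>1 W0" "W0 \<noteq> 0 \<longrightarrow> 0 < c4 L \<kappa>1 W0"
    using lyapunov_nonneg[of x0 "\<lambda>_. 0"] k6_pos unfolding W0 c4_def by simp_all
  moreover have "0 < breve_c5 L \<nu> \<kappa>1 \<kappa>2 h"
    using eps_pos k6_pos h_pos by (simp add: breve_c5_def add_pos_pos)
  ultimately show ?thesis
    using eps_pos objective_integrable objective_integral unfolding objective_def W0 by blast
qed

end
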